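(* Let $p$ be a prime, let $r \in \mathbb{N}$ and let $m_1, \ldots, m_r \in \mathbb{N}$ with $m_1 \ge \cdots \ge m_r$. Then the abelian group $G := \prod_{i=1}^r \mathbb{Z}_{p^{m_i}}$ has finitely many polynomially inequivalent congruence preserving expansions if and only if ($r \ge 2$ and $m_1 = m_2$) or ($r = 1$ and $m_1 = 1$).
   Context: $\mathbb{N}$ denotes the set of positive integers, and $\mathbb{Z}_{k}$ is the cyclic group of order $k$. A clone on a set $A$ is a set of finitary operations on $A$ (of arities $n \ge 1$) that contains all projections and is closed under composition. For an algebra $\mathbf{A}$ with universe $A$ (here a group), $\mathrm{Pol}(\mathbf{A})$ is the clone of polynomial functions of $\mathbf{A}$ (the clone generated by the fundamental operations and all constant operations), and $\mathrm{Comp}(\mathbf{A})$ is the clone of all finitary operations on $A$ that preserve every congruence of $\mathbf{A}$. An algebra $\mathbf{A}'$ on the same universe is a congruence preserving expansion of $\mathbf{A}$ if $\mathrm{Pol}(\mathbf{A}) \subseteq \mathrm{Pol}(\mathbf{A}') \subseteq \mathrm{Comp}(\mathbf{A})$. $\mathbf{A}$ has finitely many polynomially inequivalent congruence preserving expansions if the set of clones $C$ on $A$ with $\mathrm{Pol}(\mathbf{A}) \subseteq C \subseteq \mathrm{Comp}(\mathbf{A})$ is finite. *)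

theory Defs
  imports
    "HOL-Algebra.Product_Groups"
    "HOL-Library.NList"
    "HOL-Computational_Algebra.Primes"
begin

(* An operation carries its arity explicitly; the function is undefined off the n-tuples, so that
   equal operations on A are equal as HOL objects. *)
type_synonym 'a operation = "nat \<times> ('a list \<Rightarrow> 'a)"

definition operations :: "'a set \<Rightarrow> 'a operation set" where
  "operations A = {(n, f). 1 \<le> n \<and> f \<in> nlists n A \<rightarrow>\<^sub>E A}"

definition projection :: "'a set \<Rightarrow> nat \<Rightarrow> nat \<Rightarrow> 'a operation" where
  "projection A n i = (n, \<lambda>xs\<in>nlists n A. xs ! i)"

definition constant_operation :: "'a set \<Rightarrow> nat \<Rightarrow> 'a \<Rightarrow> 'a operation" where
  "constant_operation A n a = (n, \<lambda>xs\<in>nlists n A. a)"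

(* f(g_1, ..., g_n), where gs = [g_1, ..., g_n] are all k-ary and f is n-ary. *)
definition superposition ::
    "'a set \<Rightarrow> nat \<Rightarrow> ('a list \<Rightarrow> 'a) \<Rightarrow> ('a list \<Rightarrow> 'a) list \<Rightarrow> 'a operation" where
  "superposition A k f gs = (k, \<lambda>xs\<in>nlists k A. f (map (\<lambda>g. g xs) gs))"

definition is_clone :: "'a set \<Rightarrow> 'a operation set \<Rightarrow> bool" where
  "is_clone A C \<longleftrightarrow>
     C \<subseteq> operations A \<and>
     (\<forall>n i. i < n \<longrightarrow> projection A n i \<in> C) \<and>
     (\<forall>n k f gs. (n, f) \<in> C \<longrightarrow> 1 \<le> k \<longrightarrow> length gs = n \<longrightarrow> (\<forall>g\<in>set gs. (k, g) \<in> C) \<longrightarrow>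
        superposition A k f gs \<in> C)"

(* Meaningful for F \<subseteq> operations A. *)
definition clone_generated :: "'a set \<Rightarrow> 'a operation set \<Rightarrow> 'a operation set" where
  "clone_generated A F = \<Inter>{C. is_clone A C \<and> F \<subseteq> C}"

definition preserves :: "'a operation \<Rightarrow> ('a \<times> 'a) set \<Rightarrow> bool" where
  "preserves h \<theta> \<longleftrightarrow>
     (\<forall>xs ys. length xs = fst h \<longrightarrow> list_all2 (\<lambda>x y. (x, y) \<in> \<theta>) xs ys \<longrightarrow>
        (snd h xs, snd h ys) \<in> \<theta>)"

(* An algebra is given by its universe A and its set F of fundamental operations. *)
definition congruences :: "'a set \<Rightarrow> 'a operation set \<Rightarrow> ('a \<times> 'a) set set" where
  "congruences A F = {\<theta>. equiv A \<theta> \<and> (\<forall>h\<in>F. preserves h \<theta>)}"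

definition Pol :: "'a set \<Rightarrow> 'a operation set \<Rightarrow> 'a operation set" where
  "Pol A F = clone_generated A (F \<union> {constant_operation A n a | n a. 1 \<le> n \<and> a \<in> A})"

definition Comp :: "'a set \<Rightarrow> 'a operation set \<Rightarrow> 'a operation set" where
  "Comp A F = {h \<in> operations A. \<forall>\<theta>\<in>congruences A F. preserves h \<theta>}"

definition finitely_many_cp_expansions :: "'a set \<Rightarrow> 'a operation set \<Rightarrow> bool" where
  "finitely_many_cp_expansions A F \<longleftrightarrow> finite {C. is_clone A C \<and> Pol A F \<subseteq> C \<and> C \<subseteq> Comp A F}"

(* All arities are at least 1, so the neutral element appears as a unary constant. This does not
   affect the congruences, nor the polynomial functions. *)
definition group_operations :: "('a, 'b) monoid_scheme \<Rightarrow> 'a operation set" where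
  "group_operations G =
     {(2, \<lambda>xs\<in>nlists 2 (carrier G). (xs ! 0) \<otimes>\<^bsub>G\<^esub> (xs ! 1)),
      (1, \<lambda>xs\<in>nlists 1 (carrier G). inv\<^bsub>G\<^esub> (xs ! 0)),
      constant_operation (carrier G) 1 \<one>\<^bsub>G\<^esub>}"

end

(* Elements of the group are integer vectors modulo M i = p^(m i), so that identities between
   operations become congruences between integer-valued expressions.

   If m 1 = m 2 then every congruence preserving function is affine, so that Pol = Comp (Noebauer).
   A unary such function g satisfies g x - g y = t (x - y); after subtracting an affine function, g
   vanishes at 0 and at the first unit vector, and comparing a coordinate of g x with those of g at
   multiples of the first and at the second unit vector forces t to annihilate the group. For several
   variables the mixed differences h(x,y) are then multiples of both x and y; independence of the
   first two unit vectors forces them to vanish.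

   If the maximal exponent is attained only once and is at least 2, put c = p^(m 1 - 1). Every
   subgroup either lies in {x. p dvd x 1} or contains the subgroup of order p generated by c times the
   first unit vector. Hence an operation whose value is c q times the first unit vector, where q is a
   polynomial over the field with p elements in the first coordinates of the arguments, preserves
   congruences, and bounding the degree of q yields a strictly increasing sequence of clones.

   If the group is Z_p, a clone that contains a non-affine operation contains a binary operation that
   vanishes on the axes but not at (1,1); composing it with affine functions produces the
   characteristic function of every point, hence all operations. *)
theory Submission
  imports Defs "HOL-Number_Theory.Cong"
begin

section \<open>Products of cyclic groups as integer vectors\<close>

text \<open>Each case of the classification imposes its own divisibility conditions on the moduli,
  so the common setting fixes only an index set and positive moduli.\<close>

locale residue_product =
  fixes I :: "nat set" and M :: "nat \<Rightarrow> int"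
  assumes M_pos: "i \<in> I \<Longrightarrow> 0 < M i"
begin

text \<open>Normal form of an integer vector: least nonnegative residues on \<open>I\<close> and
  \<open>undefined\<close> elsewhere. These are literally the elements of the carrier of
  \<open>product_group\<close>, so nothing has to be moved along an isomorphism.\<close>

definition vec :: "(nat \<Rightarrow> int) \<Rightarrow> nat \<Rightarrow> int" where
  "vec z = (\<lambda>i\<in>I. z i mod M i)"

definition veq :: "(nat \<Rightarrow> int) \<Rightarrow> (nat \<Rightarrow> int) \<Rightarrow> bool" where
  "veq x y \<longleftrightarrow> (\<forall>i\<in>I. [x i = y i] (mod M i))"

definition A :: "(nat \<Rightarrow> int) set" where
  "A = range vec"

definition ops :: "(nat \<Rightarrow> int) operation set" where
  "ops = {(2, \<lambda>xs\<in>nlists 2 A. vec (\<lambda>i. (xs ! 0) i + (xs ! 1) i)),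
          (1, \<lambda>xs\<in>nlists 1 A. vec (\<lambda>i. - (xs ! 0) i)),
          constant_operation A 1 (vec (\<lambda>i. 0))}"

\<comment> \<open>The operation induced by a function on integer representatives. The arguments of \<open>\<phi>\<close> with index at
  least \<open>k\<close> are junk, so only functions that ignore them are of interest.\<close>
definition vop :: "nat \<Rightarrow> ((nat \<Rightarrow> nat \<Rightarrow> int) \<Rightarrow> nat \<Rightarrow> int) \<Rightarrow> (nat \<Rightarrow> int) operation" where
  "vop k \<phi> = (k, \<lambda>xs\<in>nlists k A. vec (\<phi> ((!) xs)))"

text \<open>The shape of the polynomial operations of an abelian group: \<open>b\<close> is a group
  element, whereas each coefficient \<open>c j\<close> is one integer acting on all coordinates
  alike.\<close>

definition affine :: "nat \<Rightarrow> (nat \<Rightarrow> int) \<Rightarrow> (nat \<Rightarrow> int) \<Rightarrow> (nat \<Rightarrow> nat \<Rightarrow> int) \<Rightarrow> nat \<Rightarrow> int" where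
  "affine k b c X = (\<lambda>i. b i + (\<Sum>j<k. c j * X j i))"

lemma vec_in_A [simp]: "vec z \<in> A"
  by (simp add: A_def)

lemma vec_eq_iff: "vec x = vec y \<longleftrightarrow> veq x y"
  by (auto simp: vec_def veq_def cong_def fun_eq_iff restrict_def)

lemma veq_vec [simp]: "veq (vec x) x" "veq x (vec x)"
  by (auto simp: vec_def veq_def cong_def)

lemma vec_vec [simp]: "vec (vec x) = vec x"
  by (simp add: vec_eq_iff)

lemma vec_id: "x \<in> A \<Longrightarrow> vec x = x"
  by (auto simp: A_def)

lemma veq_refl [simp]: "veq x x"
  by (simp add: veq_def)

lemma veq_sym: "veq x y \<Longrightarrow> veq y x"
  by (simp add: veq_def cong_sym)

lemma veq_trans [trans]: "veq x y \<Longrightarrow> veq y z \<Longrightarrow> veq x z"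
  by (meson veq_def cong_trans)

lemma veq_add: "veq x y \<Longrightarrow> veq x' y' \<Longrightarrow> veq (\<lambda>i. x i + x' i) (\<lambda>i. y i + y' i)"
  by (simp add: veq_def cong_add)

lemma veq_uminus: "veq x y \<Longrightarrow> veq (\<lambda>i. - x i) (\<lambda>i. - y i)"
  by (simp add: veq_def cong_minus_minus_iff)

lemma veq_diff: "veq x y \<Longrightarrow> veq x' y' \<Longrightarrow> veq (\<lambda>i. x i - x' i) (\<lambda>i. y i - y' i)"
  by (simp add: veq_def cong_diff)

lemma veq_scale: "veq x y \<Longrightarrow> veq (\<lambda>i. c * x i) (\<lambda>i. c * y i)"
  by (simp add: veq_def cong_scalar_left)

lemma veq_affine:
  assumes "\<And>j. j < k \<Longrightarrow> veq (X j) (Y j)"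
  shows "veq (affine k b c X) (affine k b c Y)"
  using assms unfolding veq_def affine_def
  by (auto intro!: cong_add cong_sum cong_scalar_left)

lemma A_eq_PiE: "A = (\<Pi>\<^sub>E i\<in>I. {0..<M i})"
proof
  show "A \<subseteq> (\<Pi>\<^sub>E i\<in>I. {0..<M i})"
    using M_pos by (auto simp: A_def vec_def)
  show "(\<Pi>\<^sub>E i\<in>I. {0..<M i}) \<subseteq> A"
  proof
    fix x assume x: "x \<in> (\<Pi>\<^sub>E i\<in>I. {0..<M i})"
    have "x = vec x"
    proof
      fix i
      show "x i = vec x i"
        using x by (cases "i \<in> I") (auto simp: vec_def PiE_def Pi_def extensional_def)
    qed
    then show "x \<in> A" by (metis vec_in_A)
  qed
qed

lemma nlists_nth_vec: "xs \<in> nlists k A \<Longrightarrow> j < k \<Longrightarrow> vec (xs ! j) = xs ! j"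
  by (simp add: nlistsE_nth_in vec_id)

lemma fst_vop [simp]: "fst (vop k \<phi>) = k"
  by (simp add: vop_def)

lemma snd_vop: "xs \<in> nlists k A \<Longrightarrow> snd (vop k \<phi>) xs = vec (\<phi> ((!) xs))"
  by (simp add: vop_def)

lemma vop_in_operations: "1 \<le> k \<Longrightarrow> vop k \<phi> \<in> operations A"
  by (auto simp: vop_def operations_def)

lemma vop_eqI:
  assumes "\<And>X. (\<And>j. j < k \<Longrightarrow> X j \<in> A) \<Longrightarrow> veq (\<phi> X) (\<psi> X)"
  shows "vop k \<phi> = vop k \<psi>"
  using assms by (auto simp: vop_def vec_eq_iff nlistsE_nth_in intro!: restrict_ext)

text \<open>Reducing the arguments first extends any operation to all integer vectors, and on tuples
  over \<open>A\<close> this reduction changes nothing. Hence arbitrary operations can be studied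
  through their action on representatives.\<close>

lemma operation_eq_vop:
  assumes "(k, f) \<in> operations A"
  shows "(k, f) = vop k (\<lambda>X. f (map (\<lambda>j. vec (X j)) [0..<k]))"
proof -
  have f: "f \<in> nlists k A \<rightarrow>\<^sub>E A" using assms by (simp add: operations_def)
  have "f xs = vec (f (map (\<lambda>j. vec (xs ! j)) [0..<k]))" if "xs \<in> nlists k A" for xs
  proof -
    have "map (\<lambda>j. vec (xs ! j)) [0..<k] = xs"
      using that by (intro nth_equalityI) (auto simp: nlists_nth_vec)
    moreover have "f xs \<in> A" using f that by auto
    ultimately show ?thesis by (simp add: vec_id)
  qed
  then have "restrict f (nlists k A) = (\<lambda>xs\<in>nlists k A. vec (f (map (\<lambda>j. vec (xs ! j)) [0..<k])))"
    by (rule restrict_ext)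
  then show ?thesis using f by (simp add: vop_def PiE_def extensional_restrict)
qed

lemma map_vec_in_nlists [simp]: "map (\<lambda>j. vec (g j)) [0..<k] \<in> nlists k A"
  by (rule nlistsI) auto

lemma ops_eq:
  "ops = {vop 2 (\<lambda>X i. X 0 i + X 1 i), vop 1 (\<lambda>X i. - X 0 i), vop 1 (\<lambda>X i. 0)}"
  by (simp add: ops_def vop_def constant_operation_def)

lemma projection_eq_vop: "j < k \<Longrightarrow> projection A k j = vop k (\<lambda>X. X j)"
  by (auto simp: vop_def projection_def nlists_nth_vec intro!: restrict_ext)

lemma constant_operation_eq_vop: "a \<in> A \<Longrightarrow> constant_operation A n a = vop n (\<lambda>X. a)"
  by (simp add: vop_def constant_operation_def vec_id)

end

section \<open>Clones containing the group operations and the constants\<close>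

locale clone_over = residue_product +
  fixes C :: "(nat \<Rightarrow> int) operation set"
  assumes clone: "is_clone A C"
    and ops_subset: "ops \<subseteq> C"
    and constants_subset: "1 \<le> n \<Longrightarrow> a \<in> A \<Longrightarrow> constant_operation A n a \<in> C"
begin

lemma in_operations: "h \<in> C \<Longrightarrow> h \<in> operations A"
  using clone by (auto simp: is_clone_def)

lemma vop_const: "1 \<le> k \<Longrightarrow> vop k (\<lambda>X. b) \<in> C"
  using constants_subset[of k "vec b"]
  by (simp add: constant_operation_eq_vop vop_def)

lemma vop_nth:
  assumes "j < k"
  shows "vop k (\<lambda>X. X j) \<in> C"
  using clone assms by (simp add: is_clone_def flip: projection_eq_vop)

text \<open>Superposition expressed on representatives. The inner \<open>vec\<close> stays because
  nothing is known about \<open>f\<close> outside the tuples over \<open>A\<close>.\<close>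

lemma vop_compose:
  assumes f: "(n, f) \<in> C" and k: "1 \<le> k" and g: "\<And>j. j < n \<Longrightarrow> vop k (\<gamma> j) \<in> C"
  shows "vop k (\<lambda>X. f (map (\<lambda>j. vec (\<gamma> j X)) [0..<n])) \<in> C"
proof -
  let ?gs = "map (\<lambda>j. snd (vop k (\<gamma> j))) [0..<n]"
  have fA: "f \<in> nlists n A \<rightarrow> A"
    using in_operations[OF f] by (auto simp: operations_def)
  have "\<forall>g\<in>set ?gs. (k, g) \<in> C"
    using g by (auto simp: vop_def)
  then have "superposition A k f ?gs \<in> C"
    using clone f k unfolding is_clone_def by auto
  moreover have "superposition A k f ?gs = vop k (\<lambda>X. f (map (\<lambda>j. vec (\<gamma> j X)) [0..<n]))"
  proof -
    have "f (map (\<lambda>g. g xs) ?gs) = vec (f (map (\<lambda>j. vec (\<gamma> j ((!) xs))) [0..<n]))"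
      if xs: "xs \<in> nlists k A" for xs
    proof -
      have "map (\<lambda>g. g xs) ?gs = map (\<lambda>j. vec (\<gamma> j ((!) xs))) [0..<n]"
        using xs by (simp add: snd_vop)
      moreover have "f (map (\<lambda>j. vec (\<gamma> j ((!) xs))) [0..<n]) \<in> A"
        using fA by (auto simp: Pi_def)
      ultimately show ?thesis by (simp only: vec_id)
    qed
    then show ?thesis
      by (auto simp: superposition_def vop_def intro!: restrict_ext)
  qed
  ultimately show ?thesis by simp
qed

lemma vop_add:
  assumes k: "1 \<le> k" and "vop k \<phi> \<in> C" and "vop k \<psi> \<in> C"
  shows "vop k (\<lambda>X i. \<phi> X i + \<psi> X i) \<in> C"
proof -
  let ?f = "\<lambda>xs\<in>nlists 2 A. vec (\<lambda>i. (xs ! 0) i + (xs ! 1) i)"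
  have f: "(2, ?f) \<in> C" using ops_subset by (simp add: ops_def)
  have "vop k (\<lambda>X. ?f (map (\<lambda>j. vec ((if j = 0 then \<phi> else \<psi>) X)) [0..<2])) \<in> C"
    by (rule vop_compose[OF f k]) (use assms in auto)
  also have "vop k (\<lambda>X. ?f (map (\<lambda>j. vec ((if j = 0 then \<phi> else \<psi>) X)) [0..<2]))
     = vop k (\<lambda>X i. \<phi> X i + \<psi> X i)"
  proof (rule vop_eqI)
    fix X
    have "veq (vec (\<lambda>i. vec (\<phi> X) i + vec (\<psi> X) i)) (\<lambda>i. \<phi> X i + \<psi> X i)"
      by (rule veq_trans[OF veq_vec(1) veq_add[OF veq_vec(1) veq_vec(1)]])
    moreover have "map (\<lambda>j. vec ((if j = 0 then \<phi> else \<psi>) X)) [0..<2] \<in> nlists 2 A"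
      by (rule map_vec_in_nlists)
    ultimately show "veq (?f (map (\<lambda>j. vec ((if j = 0 then \<phi> else \<psi>) X)) [0..<2]))
      (\<lambda>i. \<phi> X i + \<psi> X i)"
      by simp
  qed
  finally show ?thesis .
qed

lemma vop_uminus:
  assumes k: "1 \<le> k" and "vop k \<phi> \<in> C"
  shows "vop k (\<lambda>X i. - \<phi> X i) \<in> C"
proof -
  let ?f = "\<lambda>xs\<in>nlists 1 A. vec (\<lambda>i. - (xs ! 0) i)"
  have f: "(1, ?f) \<in> C" using ops_subset by (simp add: ops_def)
  have "vop k (\<lambda>X. ?f (map (\<lambda>j. vec (\<phi> X)) [0..<1])) \<in> C"
    by (rule vop_compose[OF f k]) (use assms in auto)
  also have "vop k (\<lambda>X. ?f (map (\<lambda>j. vec (\<phi> X)) [0..<1])) = vop k (\<lambda>X i. - \<phi> X i)"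
  proof (rule vop_eqI)
    fix X
    have "veq (vec (\<lambda>i. - vec (\<phi> X) i)) (\<lambda>i. - \<phi> X i)"
      by (rule veq_trans[OF veq_vec(1) veq_uminus[OF veq_vec(1)]])
    moreover have "map (\<lambda>j. vec (\<phi> X)) [0..<1] \<in> nlists 1 A"
      by (rule map_vec_in_nlists)
    ultimately show "veq (?f (map (\<lambda>j. vec (\<phi> X)) [0..<1])) (\<lambda>i. - \<phi> X i)"
      by simp
  qed
  finally show ?thesis .
qed

lemma vop_scale:
  assumes k: "1 \<le> k" and \<phi>: "vop k \<phi> \<in> C"
  shows "vop k (\<lambda>X i. c * \<phi> X i) \<in> C"
proof -
  have nat: "vop k (\<lambda>X i. int n * \<phi> X i) \<in> C" for n
  proof (induction n)
    case 0
    show ?case using vop_const[OF k, of "\<lambda>i. 0"] by simp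
  next
    case (Suc n)
    show ?case using vop_add[OF k \<phi> Suc] by (simp add: distrib_right)
  qed
  show ?thesis
  proof (cases "0 \<le> c")
    case True
    then show ?thesis using nat[of "nat c"] by simp
  next
    case False
    then show ?thesis using vop_uminus[OF k nat[of "nat (- c)"]] by simp
  qed
qed

lemma vop_sum:
  assumes k: "1 \<le> k" and "finite S" and "\<And>s. s \<in> S \<Longrightarrow> vop k (\<phi> s) \<in> C"
  shows "vop k (\<lambda>X i. \<Sum>s\<in>S. \<phi> s X i) \<in> C"
  using assms(2,3)
proof (induction S rule: finite_induct)
  case empty
  show ?case using vop_const[OF k, of "\<lambda>i. 0"] by simp
next
  case (insert s S)
  then show ?case using vop_add[OF k, of "\<phi> s"] by simp
qed

lemma vop_affine: "1 \<le> k \<Longrightarrow> vop k (affine k b c) \<in> C"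
  unfolding affine_def
  by (intro vop_add vop_const vop_sum vop_scale vop_nth) auto

end

context residue_product
begin

text \<open>\<open>Pol\<close> is an intersection of clones, and each of these contains the group
  operations and the constants, hence all affine operations.\<close>

lemma affine_in_Pol:
  assumes "1 \<le> k"
  shows "vop k (affine k b c) \<in> Pol A ops"
  unfolding Pol_def clone_generated_def
proof (rule InterI, clarify)
  fix C assume "is_clone A C" "ops \<union> {constant_operation A n a |n a. 1 \<le> n \<and> a \<in> A} \<subseteq> C"
  then interpret clone_over I M C by unfold_locales auto
  show "vop k (affine k b c) \<in> C" using assms by (rule vop_affine)
qed

lemma clone_over_Pol:
  assumes "is_clone A C" "Pol A ops \<subseteq> C"
  shows "clone_over I M C"
proof -
  have "ops \<union> {constant_operation A n a |n a. 1 \<le> n \<and> a \<in> A} \<subseteq> Pol A ops"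
    unfolding Pol_def clone_generated_def by blast
  with assms(2) have "ops \<union> {constant_operation A n a |n a. 1 \<le> n \<and> a \<in> A} \<subseteq> C"
    by (rule order_trans[rotated])
  then show ?thesis using assms(1) by unfold_locales blast+
qed

lemma Pol_subset:
  assumes "is_clone A C" "ops \<subseteq> C" "\<And>n a. 1 \<le> n \<Longrightarrow> a \<in> A \<Longrightarrow> constant_operation A n a \<in> C"
  shows "Pol A ops \<subseteq> C"
  unfolding Pol_def clone_generated_def using assms by blast

end

text \<open>Both descriptions use restricted functions with values in the residue systems, so the
  carriers and the operations are equal and not merely isomorphic.\<close>

lemma residue_product_group:
  fixes p :: nat and m :: "nat \<Rightarrow> nat" and I :: "nat set"
  assumes "0 < p"
  defines "G \<equiv> product_group I (\<lambda>i. integer_mod_group (p ^ m i))"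
  shows "residue_product I (\<lambda>i. int p ^ m i)"
    and "carrier G = residue_product.A I (\<lambda>i. int p ^ m i)"
    and "group_operations G = residue_product.ops I (\<lambda>i. int p ^ m i)"
proof -
  show "residue_product I (\<lambda>i. int p ^ m i)" using assms by unfold_locales simp
  then interpret residue_product I "\<lambda>i. int p ^ m i" .
  show carrier: "carrier G = A"
    using assms by (simp add: A_eq_PiE G_def carrier_integer_mod_group)
  have mult: "x \<otimes>\<^bsub>G\<^esub> y = vec (\<lambda>i. x i + y i)" for x y
    by (simp add: G_def vec_def)
  have inv: "inv\<^bsub>G\<^esub> x = vec (\<lambda>i. - x i)" if "x \<in> A" for x
  proof -
    have "x \<in> carrier G" using that carrier by simp
    then show ?thesis
      unfolding G_def by (subst inv_product_group) (auto simp: vec_def PiE_def Pi_def intro!: restrict_ext)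
  qed
  have one: "\<one>\<^bsub>G\<^esub> = vec (\<lambda>i. 0)"
    by (simp add: G_def vec_def)
  have "(\<lambda>xs\<in>nlists 1 A. inv\<^bsub>G\<^esub> (xs ! 0)) = (\<lambda>xs\<in>nlists 1 A. vec (\<lambda>i. - (xs ! 0) i))"
    by (intro restrict_ext inv) (simp add: nlistsE_nth_in)
  then show "group_operations G = ops"
    unfolding group_operations_def ops_def carrier one by (simp add: mult)
qed

section \<open>Two factors of maximal order\<close>

lemma list_all2_nlists:
  assumes "\<theta> \<subseteq> A \<times> A" "list_all2 (\<lambda>x y. (x, y) \<in> \<theta>) xs ys" "length xs = k"
  shows "xs \<in> nlists k A \<and> ys \<in> nlists k A"
proof -
  have "length ys = k" using assms by (simp add: list_all2_lengthD)
  moreover have "(xs ! j, ys ! j) \<in> A \<times> A" if "j < k" for j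
    using assms that by (auto simp: list_all2_conv_all_nth)
  ultimately show ?thesis
    using assms(3) by (force simp: in_set_conv_nth intro!: nlistsI)
qed

lemma preserves_map:
  assumes "preserves (k, f) \<theta>" "\<And>j. j < k \<Longrightarrow> (g j, g' j) \<in> \<theta>"
  shows "(f (map g [0..<k]), f (map g' [0..<k])) \<in> \<theta>"
proof -
  have "list_all2 (\<lambda>x y. (x, y) \<in> \<theta>) (map g [0..<k]) (map g' [0..<k])"
    using assms(2) by (simp add: list_all2_conv_all_nth)
  with assms(1) show ?thesis unfolding preserves_def by force
qed

text \<open>\<open>N\<close> annihilates the whole group, and an integer that kills a vector with
  entry 1 or -1 at \<open>i1\<close> or \<open>i2\<close> must be divisible by
  \<open>N\<close>.\<close>

locale two_maximal_factors = residue_product +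
  fixes N :: int and i1 i2 :: nat
  assumes i12: "i1 \<in> I" "i2 \<in> I" "i1 \<noteq> i2"
    and M12: "M i1 = N" "M i2 = N"
    and M_dvd: "i \<in> I \<Longrightarrow> M i dvd N"
begin

lemma veq_imp_cong: "veq x y \<Longrightarrow> j \<in> {i1, i2} \<Longrightarrow> [x j = y j] (mod N)"
  using i12 M12 by (auto simp: veq_def)

lemma veq_mult_zero:
  assumes "[t = 0] (mod N)"
  shows "veq (\<lambda>i. t * z i) (\<lambda>i. 0)"
proof -
  have "M i dvd t" if "i \<in> I" for i
    using assms M_dvd[OF that] by (meson cong_0_iff dvd_trans)
  then show ?thesis by (simp add: veq_def cong_0_iff)
qed

text \<open>Adding a multiple of \<open>d\<close> does not move a coordinate in which
  \<open>d\<close> vanishes.\<close>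

lemma veq_multiple_coordinate:
  assumes d: "veq (\<lambda>i. x i - y i) (\<lambda>i. t * d i)" and y: "veq y (\<lambda>i. 0)"
    and j: "j \<in> {i1, i2}" and "d j = 0"
  shows "[x j = 0] (mod N)"
  using veq_imp_cong[OF d j] veq_imp_cong[OF y j] \<open>d j = 0\<close>
  by (simp add: cong_0_iff) (metis dvd_add diff_add_cancel)

text \<open>Where \<open>d\<close> has entry 1 or -1, coordinate \<open>j\<close> determines the
  scalar \<open>t\<close> modulo \<open>N\<close>. If that coordinate vanishes, \<open>t\<close>
  annihilates the group and the whole multiple vanishes.\<close>

lemma veq_multiple_zero:
  assumes d: "veq (\<lambda>i. x i - y i) (\<lambda>i. t * d i)" and y: "veq y (\<lambda>i. 0)"
    and j: "j \<in> {i1, i2}" and dj: "d j = 1 \<or> d j = -1" and x: "[x j = 0] (mod N)"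
  shows "veq x (\<lambda>i. 0)"
proof -
  have "N dvd x j - y j"
    using x veq_imp_cong[OF y j] by (simp add: cong_0_iff)
  moreover have "N dvd (x j - y j) - t * d j"
    using veq_imp_cong[OF d j] by (simp add: cong_iff_dvd_diff)
  ultimately have "N dvd t * d j"
    by (metis dvd_diff_right_iff)
  then have "[t = 0] (mod N)" using dj by (auto simp: cong_0_iff)
  then have "veq (\<lambda>i. x i - y i) (\<lambda>i. 0)"
    using d veq_mult_zero veq_trans by blast
  from veq_add[OF this y] show ?thesis by simp
qed

lemma unary_affine:
  assumes g: "\<And>x y. \<exists>t. veq (\<lambda>i. g x i - g y i) (\<lambda>i. t * (x i - y i))"
  shows "\<exists>a. \<forall>x. veq (g x) (\<lambda>i. g (\<lambda>_. 0) i + a * x i)"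
proof -
  define e :: "nat \<Rightarrow> nat \<Rightarrow> int" where "e = (\<lambda>j i. if i = j then 1 else 0)"
  have e [simp]: "e i1 i1 = 1" "e i2 i2 = 1" "e i1 i2 = 0" "e i2 i1 = 0"
    using i12 by (auto simp: e_def)
  obtain a where a: "veq (\<lambda>i. g (e i1) i - g (\<lambda>_. 0) i) (\<lambda>i. a * (e i1 i - 0))"
    using g by blast
  define h where "h x = (\<lambda>i. g x i - g (\<lambda>_. 0) i - a * x i)" for x
  have h: "\<exists>t. veq (\<lambda>i. h x i - h y i) (\<lambda>i. t * (x i - y i))" for x y
  proof -
    obtain t where "veq (\<lambda>i. g x i - g y i) (\<lambda>i. t * (x i - y i))" using g by blast
    from veq_diff[OF this veq_refl[of "\<lambda>i. a * (x i - y i)"]]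
    have "veq (\<lambda>i. h x i - h y i) (\<lambda>i. (t - a) * (x i - y i))"
      by (simp add: h_def algebra_simps)
    then show ?thesis ..
  qed
  have h0: "veq (h (\<lambda>_. 0)) (\<lambda>i. 0)"
    by (simp add: h_def)
  have h1: "veq (h (e i1)) (\<lambda>i. 0)"
    using veq_diff[OF a veq_refl[of "\<lambda>i. a * e i1 i"]] by (simp add: h_def)
  have coordinate: "[h x j = 0] (mod N)"
    if "veq (h y) (\<lambda>i. 0)" "j \<in> {i1, i2}" "x j = y j" for x y j
    using h[of x y] veq_multiple_coordinate[OF _ that(1,2), of "h x" _ "\<lambda>i. x i - y i"] that(3)
    by auto
  have zero: "veq (h x) (\<lambda>i. 0)"
    if "veq (h y) (\<lambda>i. 0)" "j \<in> {i1, i2}" "x j - y j = 1 \<or> x j - y j = - 1" "[h x j = 0] (mod N)"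
    for x y j
    using h[of x y] veq_multiple_zero[OF _ that(1,2), of "h x" _ "\<lambda>i. x i - y i"] that(3,4)
    by blast
  \<comment> \<open>Zeros of \<open>h\<close> spread by two comparisons: a known zero that agrees
    with the new point in coordinate \<open>j\<close> makes \<open>h\<close> vanish in that
    coordinate, and a known zero that differs there by 1 or -1 then makes it vanish entirely. The
    zeros 0 and \<open>e i1\<close> give \<open>e i2\<close>, then all multiples of
    \<open>e i1\<close>, then every point.\<close>
  have h2: "veq (h (e i2)) (\<lambda>i. 0)"
    by (rule zero[OF h1, of i1]) (use coordinate[OF h0, of i1 "e i2"] in auto)
  have h3: "veq (h (\<lambda>i. c * e i1 i)) (\<lambda>i. 0)" for c
    by (rule zero[OF h2, of i2]) (use coordinate[OF h0, of i2 "\<lambda>i. c * e i1 i"] in auto)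
  have "veq (h x) (\<lambda>i. 0)" for x
    by (rule zero[OF h3[of "x i1 - 1"], of i1]) (use coordinate[OF h3[of "x i1"], of i1 x] in auto)
  then have "veq (\<lambda>i. h x i + (g (\<lambda>_. 0) i + a * x i)) (\<lambda>i. 0 + (g (\<lambda>_. 0) i + a * x i))" for x
    by (intro veq_add) auto
  then have "veq (g x) (\<lambda>i. g (\<lambda>_. 0) i + a * x i)" for x
    by (simp add: h_def)
  then show ?thesis by blast
qed

text \<open>All sections of \<open>H\<close> are affine by \<open>unary_affine\<close>, so the mixed
  difference \<open>h x y\<close> is a multiple of \<open>x\<close> with a scalar depending on
  \<open>y\<close>, and a multiple of \<open>y\<close> with a scalar depending on \<open>x\<close>.
  The two forms are compatible only if \<open>h\<close> vanishes.\<close>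

lemma binary_mixed_difference:
  assumes H1: "\<And>x x' y. \<exists>t. veq (\<lambda>i. H x y i - H x' y i) (\<lambda>i. t * (x i - x' i))"
    and H2: "\<And>x y y'. \<exists>t. veq (\<lambda>i. H x y i - H x y' i) (\<lambda>i. t * (y i - y' i))"
  shows "veq (\<lambda>i. H x y i - H (\<lambda>_. 0) y i) (\<lambda>i. H x (\<lambda>_. 0) i - H (\<lambda>_. 0) (\<lambda>_. 0) i)"
proof -
  define e :: "nat \<Rightarrow> nat \<Rightarrow> int" where "e = (\<lambda>j i. if i = j then 1 else 0)"
  have e [simp]: "e i1 i1 = 1" "e i2 i2 = 1" "e i1 i2 = 0" "e i2 i1 = 0"
    using i12 by (auto simp: e_def)
  have "\<exists>a. \<forall>x. veq (H x y) (\<lambda>i. H (\<lambda>_. 0) y i + a * x i)" for y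
    by (rule unary_affine[of "\<lambda>x. H x y"]) (rule H1)
  then obtain a where a: "\<And>x y. veq (H x y) (\<lambda>i. H (\<lambda>_. 0) y i + a y * x i)"
    by metis
  have "\<exists>b. \<forall>y. veq (H x y) (\<lambda>i. H x (\<lambda>_. 0) i + b * y i)" for x
    by (rule unary_affine[of "H x"]) (rule H2)
  then obtain b where b: "\<And>x y. veq (H x y) (\<lambda>i. H x (\<lambda>_. 0) i + b x * y i)"
    by metis
  define h where "h x y = (\<lambda>i. H x y i - H (\<lambda>_. 0) y i - (H x (\<lambda>_. 0) i - H (\<lambda>_. 0) (\<lambda>_. 0) i))" for x y
  have ha: "veq (h x y) (\<lambda>i. (a y - a (\<lambda>_. 0)) * x i)" for x y
    using veq_diff[OF veq_diff[OF a[of x y] veq_refl[of "H (\<lambda>_. 0) y"]]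
        veq_diff[OF a[of x "\<lambda>_. 0"] veq_refl[of "H (\<lambda>_. 0) (\<lambda>_. 0)"]]]
    by (simp add: h_def algebra_simps)
  have hb: "veq (h x y) (\<lambda>i. (b x - b (\<lambda>_. 0)) * y i)" for x y
    using veq_diff[OF veq_diff[OF b[of x y] veq_refl[of "H x (\<lambda>_. 0)"]]
        veq_diff[OF b[of "\<lambda>_. 0" y] veq_refl[of "H (\<lambda>_. 0) (\<lambda>_. 0)"]]]
    by (simp add: h_def algebra_simps)
  \<comment> \<open>Coordinate \<open>i1\<close> of \<open>h (e i1) (e i2)\<close> is the scalar
    itself in the first form and 0 in the second. So \<open>h x (e i2)\<close> vanishes for all
    \<open>x\<close>, and its coordinate \<open>i2\<close> then shows that the other scalar vanishes
    for all \<open>x\<close>.\<close>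
  have "[a (e i2) - a (\<lambda>_. 0) = 0] (mod N)"
    using veq_imp_cong[OF veq_trans[OF veq_sym[OF ha] hb], of i1 "e i2" "e i1"] by simp
  then have "veq (h x (e i2)) (\<lambda>i. 0)" for x
    using ha veq_mult_zero veq_trans by blast
  then have "[b x - b (\<lambda>_. 0) = 0] (mod N)" for x
    using veq_imp_cong[OF veq_trans[OF veq_sym[OF hb]], of x "e i2" "\<lambda>i. 0" i2] by simp
  then have "veq (h x y) (\<lambda>i. 0)"
    using hb veq_mult_zero veq_trans by blast
  from veq_add[OF this veq_refl[of "\<lambda>i. H x (\<lambda>_. 0) i - H (\<lambda>_. 0) (\<lambda>_. 0) i"]]
  show ?thesis by (simp add: h_def)
qed

text \<open>The hypothesis is preservation of the congruences modulo all cyclic subgroups,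
  \<open>d\<close> being the generator. Vanishing mixed differences make the increment in one
  argument independent of the others, so \<open>F\<close> is a sum of unary functions, each of them
  affine.\<close>

lemma cyclic_preserving_affine:
  assumes F: "\<And>X Y d. (\<And>j. j < k \<Longrightarrow> \<exists>t. veq (\<lambda>i. X j i - Y j i) (\<lambda>i. t * d i)) \<Longrightarrow>
      \<exists>t. veq (\<lambda>i. F X i - F Y i) (\<lambda>i. t * d i)"
  shows "\<exists>b c. \<forall>X. veq (F X) (affine k b c X)"
proof -
  define z\<^sub>0 :: "nat \<Rightarrow> nat \<Rightarrow> int" where "z\<^sub>0 = (\<lambda>_ _. 0)"
  \<comment> \<open>The trivial subgroup, \<open>d = 0\<close>, already shows that arguments with
    index at least \<open>k\<close> do not matter.\<close>
  have F_cong: "veq (F X) (F Y)" if "\<And>j. j < k \<Longrightarrow> X j = Y j" for X Y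
  proof -
    have "\<exists>t. veq (\<lambda>i. F X i - F Y i) (\<lambda>i. t * 0)"
      by (rule F) (simp add: that)
    then have "veq (\<lambda>i. F X i - F Y i) (\<lambda>i. 0)" by simp
    from veq_add[OF this veq_refl[of "F Y"]] show ?thesis by simp
  qed
  have sect: "\<exists>t. veq (\<lambda>i. F (X(j := x)) i - F (X(j := y)) i) (\<lambda>i. t * (x i - y i))" for X j x y
  proof (rule F)
    fix l
    show "\<exists>t. veq (\<lambda>i. (X(j := x)) l i - (X(j := y)) l i) (\<lambda>i. t * (x i - y i))"
      by (rule exI[of _ "if l = j then 1 else 0"]) simp
  qed
  have "\<exists>a. \<forall>x. veq (F (z\<^sub>0(j := x))) (\<lambda>i. F (z\<^sub>0(j := \<lambda>_. 0)) i + a * x i)" for j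
    by (rule unary_affine[of "\<lambda>x. F (z\<^sub>0(j := x))"]) (rule sect)
  moreover have [simp]: "z\<^sub>0(j := \<lambda>_. 0) = z\<^sub>0" for j by (auto simp: z\<^sub>0_def)
  ultimately obtain c where c: "\<And>j x. veq (F (z\<^sub>0(j := x))) (\<lambda>i. F z\<^sub>0 i + c j * x i)"
    by (simp only:) metis
  have mixed: "veq (\<lambda>i. F X i - F (X(j := \<lambda>_. 0)) i) (\<lambda>i. F (z\<^sub>0(j := X j)) i - F z\<^sub>0 i)" for X j
  proof -
    \<comment> \<open>The arguments other than the \<open>j\<close>-th are set to zero one at a
      time. Each replacement keeps the increment in argument \<open>j\<close>, by the mixed
      difference in \<open>j\<close> and \<open>n\<close>; after \<open>k\<close> replacements only
      argument \<open>j\<close> can influence \<open>F\<close>.\<close>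
    define Z where "Z n = (\<lambda>l. if l < n \<and> l \<noteq> j then (\<lambda>_. 0) else X l)" for n
    have step: "veq (\<lambda>i. F X i - F (X(j := \<lambda>_. 0)) i) (\<lambda>i. F (Z n) i - F ((Z n)(j := \<lambda>_. 0)) i)" for n
    proof (induction n)
      case 0
      then show ?case by (simp add: Z_def)
    next
      case (Suc n)
      show ?case
      proof (cases "n = j")
        case True
        then have "Z (Suc n) = Z n" by (auto simp: Z_def)
        then show ?thesis using Suc by simp
      next
        case False
        define H where "H x y = F ((Z n)(j := x, n := y))" for x y
        have "veq (\<lambda>i. H (X j) (X n) i - H (\<lambda>_. 0) (X n) i)
          (\<lambda>i. H (X j) (\<lambda>_. 0) i - H (\<lambda>_. 0) (\<lambda>_. 0) i)"
        proof (rule binary_mixed_difference)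
          show "\<exists>t. veq (\<lambda>i. H x y i - H x' y i) (\<lambda>i. t * (x i - x' i))" for x x' y
            using sect[of "(Z n)(n := y)" j x x'] False by (simp add: H_def fun_upd_twist)
          show "\<exists>t. veq (\<lambda>i. H x y i - H x y' i) (\<lambda>i. t * (y i - y' i))" for x y y'
            unfolding H_def by (rule sect)
        qed
        moreover have "(Z n)(j := X j, n := X n) = Z n" "(Z n)(j := (\<lambda>_. 0), n := X n) = (Z n)(j := (\<lambda>_. 0))"
          "(Z n)(j := X j, n := (\<lambda>_. 0)) = Z (Suc n)"
          "(Z n)(j := (\<lambda>_. 0), n := (\<lambda>_. 0)) = (Z (Suc n))(j := (\<lambda>_. 0))"
          using False by (auto simp: Z_def fun_eq_iff)
        ultimately have "veq (\<lambda>i. F (Z n) i - F ((Z n)(j := \<lambda>_. 0)) i)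
            (\<lambda>i. F (Z (Suc n)) i - F ((Z (Suc n))(j := \<lambda>_. 0)) i)"
          by (simp only: H_def)
        with Suc show ?thesis by (rule veq_trans)
      qed
    qed
    have "veq (\<lambda>i. F (Z k) i - F ((Z k)(j := \<lambda>_. 0)) i) (\<lambda>i. F (z\<^sub>0(j := X j)) i - F z\<^sub>0 i)"
      by (intro veq_diff F_cong) (auto simp: Z_def z\<^sub>0_def)
    then show ?thesis using step veq_trans by blast
  qed
  \<comment> \<open>A telescoping sum: setting argument \<open>j\<close> to zero costs
    \<open>c j * X j\<close>, whatever the remaining arguments are.\<close>
  have sum: "veq (F X) (\<lambda>i. F (\<lambda>l. if l < n then (\<lambda>_. 0) else X l) i + (\<Sum>j<n. c j * X j i))" for X n
  proof (induction n)
    case 0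
    show ?case by simp
  next
    case (Suc n)
    let ?W = "\<lambda>n l. if l < n then (\<lambda>_. 0) else X l"
    have "(?W n)(n := (\<lambda>_. 0)) = ?W (Suc n)" by (auto simp: fun_eq_iff)
    moreover have "?W n n = X n" by simp
    ultimately have "veq (\<lambda>i. F (?W n) i - F (?W (Suc n)) i) (\<lambda>i. F (z\<^sub>0(n := X n)) i - F z\<^sub>0 i)"
      using mixed[of "?W n" n] by (simp only:)
    also have "veq \<dots> (\<lambda>i. (F z\<^sub>0 i + c n * X n i) - F z\<^sub>0 i)"
      by (intro veq_diff c veq_refl)
    finally have "veq (\<lambda>i. (F (?W n) i - F (?W (Suc n)) i) + (F (?W (Suc n)) i + (\<Sum>j<n. c j * X j i)))
       (\<lambda>i. ((F z\<^sub>0 i + c n * X n i) - F z\<^sub>0 i) + (F (?W (Suc n)) i + (\<Sum>j<n. c j * X j i)))"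
      by (rule veq_add) (rule veq_refl)
    then have "veq (\<lambda>i. F (?W n) i + (\<Sum>j<n. c j * X j i))
        (\<lambda>i. F (?W (Suc n)) i + (\<Sum>j<Suc n. c j * X j i))"
      by (simp add: algebra_simps)
    with Suc.IH show ?case by (rule veq_trans)
  qed
  have "veq (F X) (affine k (F z\<^sub>0) c X)" for X
    unfolding affine_def
    by (rule veq_trans[OF sum[of X k]], intro veq_add F_cong) (auto simp: z\<^sub>0_def)
  then show ?thesis by blast
qed

end

section \<open>Congruences modulo cyclic subgroups\<close>

context residue_product
begin

lemma preserves_vop:
  assumes "equiv A \<theta>"
    and "\<And>X Y. (\<And>j. j < k \<Longrightarrow> (X j, Y j) \<in> \<theta>) \<Longrightarrow> (vec (\<phi> X), vec (\<phi> Y)) \<in> \<theta>"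
  shows "preserves (vop k \<phi>) \<theta>"
  unfolding preserves_def fst_vop
proof (intro allI impI)
  fix xs ys assume lx: "length xs = k" and rel: "list_all2 (\<lambda>x y. (x, y) \<in> \<theta>) xs ys"
  have sub: "\<theta> \<subseteq> A \<times> A" using assms(1) by (rule equivE)
  have "xs \<in> nlists k A" "ys \<in> nlists k A"
    using list_all2_nlists[OF sub rel lx] by auto
  moreover have "(vec (\<phi> ((!) xs)), vec (\<phi> ((!) ys))) \<in> \<theta>"
    by (rule assms(2)) (use lx rel in \<open>simp add: list_all2_conv_all_nth\<close>)
  ultimately show "(snd (vop k \<phi>) xs, snd (vop k \<phi>) ys) \<in> \<theta>"
    by (simp add: snd_vop)
qed

lemma cyclic_congruence:
  "{(x, y) \<in> A \<times> A. \<exists>t. veq (\<lambda>i. x i - y i) (\<lambda>i. t * d i)} \<in> congruences A ops"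
    (is "?\<theta> \<in> _")
proof -
  \<comment> \<open>Membership may be tested on any representatives, which reduces compatibility
    with the operations to integer arithmetic.\<close>
  have mult: "(vec x, vec y) \<in> ?\<theta> \<longleftrightarrow> (\<exists>t. veq (\<lambda>i. x i - y i) (\<lambda>i. t * d i))" for x y
    using veq_diff[OF veq_vec(1)[of x] veq_vec(1)[of y]] veq_diff[OF veq_vec(2)[of x] veq_vec(2)[of y]]
    by simp (meson veq_trans)
  have "equiv A ?\<theta>"
  proof (rule equivI)
    show "?\<theta> \<subseteq> A \<times> A" by blast
    show "refl_on A ?\<theta>" by (auto intro!: refl_onI exI[of _ 0])
    show "sym ?\<theta>"
    proof (rule symI)
      fix x y assume "(x, y) \<in> ?\<theta>"
      then obtain t where "x \<in> A" "y \<in> A" "veq (\<lambda>i. x i - y i) (\<lambda>i. t * d i)" by blast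
      moreover from veq_uminus[OF this(3)] have "veq (\<lambda>i. y i - x i) (\<lambda>i. (- t) * d i)" by simp
      ultimately show "(y, x) \<in> ?\<theta>" by blast
    qed
    show "trans ?\<theta>"
    proof (rule transI)
      fix x y z assume "(x, y) \<in> ?\<theta>" "(y, z) \<in> ?\<theta>"
      then obtain t t' where "x \<in> A" "z \<in> A" "veq (\<lambda>i. x i - y i) (\<lambda>i. t * d i)"
        "veq (\<lambda>i. y i - z i) (\<lambda>i. t' * d i)" by blast
      moreover from veq_add[OF this(3,4)] have "veq (\<lambda>i. x i - z i) (\<lambda>i. (t + t') * d i)"
        by (simp add: algebra_simps)
      ultimately show "(x, z) \<in> ?\<theta>" by blast
    qed
  qed
  moreover have "preserves h ?\<theta>" if h: "h \<in> ops" for h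
  proof -
    consider "h = vop 2 (\<lambda>X i. X 0 i + X 1 i)" | "h = vop 1 (\<lambda>X i. - X 0 i)" | "h = vop 1 (\<lambda>X i. 0)"
      using h unfolding ops_eq by blast
    then show ?thesis
    proof cases
      case 1
      show ?thesis
        unfolding 1
      proof (rule preserves_vop[OF \<open>equiv A ?\<theta>\<close>])
        fix X Y :: "nat \<Rightarrow> nat \<Rightarrow> int" assume "\<And>j. j < 2 \<Longrightarrow> (X j, Y j) \<in> ?\<theta>"
        from this[of 0] this[of 1] obtain t t' where "veq (\<lambda>i. X 0 i - Y 0 i) (\<lambda>i. t * d i)"
          "veq (\<lambda>i. X 1 i - Y 1 i) (\<lambda>i. t' * d i)" by auto
        from veq_add[OF this] have
          "veq (\<lambda>i. (X 0 i + X 1 i) - (Y 0 i + Y 1 i)) (\<lambda>i. (t + t') * d i)"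
          by (simp add: algebra_simps)
        then show "(vec (\<lambda>i. X 0 i + X 1 i), vec (\<lambda>i. Y 0 i + Y 1 i)) \<in> ?\<theta>"
          unfolding mult by blast
      qed
    next
      case 2
      show ?thesis
        unfolding 2
      proof (rule preserves_vop[OF \<open>equiv A ?\<theta>\<close>])
        fix X Y :: "nat \<Rightarrow> nat \<Rightarrow> int" assume "\<And>j. j < 1 \<Longrightarrow> (X j, Y j) \<in> ?\<theta>"
        from this[of 0] obtain t where "veq (\<lambda>i. X 0 i - Y 0 i) (\<lambda>i. t * d i)" by auto
        from veq_uminus[OF this] have "veq (\<lambda>i. - X 0 i - - Y 0 i) (\<lambda>i. (- t) * d i)"
          by (simp add: algebra_simps)
        then show "(vec (\<lambda>i. - X 0 i), vec (\<lambda>i. - Y 0 i)) \<in> ?\<theta>"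
          unfolding mult by blast
      qed
    next
      case 3
      show ?thesis
        unfolding 3
        by (rule preserves_vop[OF \<open>equiv A ?\<theta>\<close>], unfold mult) (rule exI[of _ 0], simp)
    qed
  qed
  ultimately show ?thesis by (simp add: congruences_def)
qed

end

context two_maximal_factors
begin

text \<open>Preserving the congruences modulo cyclic subgroups is already enough to force an
  operation to be affine.\<close>

lemma Comp_subset_Pol: "Comp A ops \<subseteq> Pol A ops"
proof clarify
  fix k f assume h: "(k, f) \<in> Comp A ops"
  then have op: "(k, f) \<in> operations A" by (simp add: Comp_def)
  then have k: "1 \<le> k" and fA: "f \<in> nlists k A \<rightarrow> A" by (auto simp: operations_def)
  define F where "F X = f (map (\<lambda>j. vec (X j)) [0..<k])" for X
  have "\<exists>b c. \<forall>X. veq (F X) (affine k b c X)"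
  proof (rule cyclic_preserving_affine)
    fix X Y :: "nat \<Rightarrow> nat \<Rightarrow> int" and d :: "nat \<Rightarrow> int"
    assume XY: "\<And>j. j < k \<Longrightarrow> \<exists>t. veq (\<lambda>i. X j i - Y j i) (\<lambda>i. t * d i)"
    let ?\<theta> = "{(x, y) \<in> A \<times> A. \<exists>t. veq (\<lambda>i. x i - y i) (\<lambda>i. t * d i)}"
    have "preserves (k, f) ?\<theta>" using h cyclic_congruence[of d] by (auto simp: Comp_def)
    moreover have "(vec (X j), vec (Y j)) \<in> ?\<theta>" if j: "j < k" for j
    proof -
      obtain t where "veq (\<lambda>i. X j i - Y j i) (\<lambda>i. t * d i)" using XY[OF j] ..
      then have "veq (\<lambda>i. vec (X j) i - vec (Y j) i) (\<lambda>i. t * d i)"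
        by (rule veq_trans[OF veq_diff[OF veq_vec(1) veq_vec(1)]])
      then show ?thesis by auto
    qed
    ultimately have "(F X, F Y) \<in> ?\<theta>"
      unfolding F_def by (rule preserves_map)
    then show "\<exists>t. veq (\<lambda>i. F X i - F Y i) (\<lambda>i. t * d i)" by blast
  qed
  then obtain b c where "\<And>X. veq (F X) (affine k b c X)" by blast
  then have "vop k F = vop k (affine k b c)" by (intro vop_eqI)
  then have "(k, f) = vop k (affine k b c)"
    using operation_eq_vop[OF op] unfolding F_def by simp
  then show "(k, f) \<in> Pol A ops" using affine_in_Pol[OF k] by simp
qed

lemma finitely_many_expansions: "finitely_many_cp_expansions A ops"
proof -
  have "{C. is_clone A C \<and> Pol A ops \<subseteq> C \<and> C \<subseteq> Comp A ops} \<subseteq> {Pol A ops}"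
    using Comp_subset_Pol by auto
  then show ?thesis
    unfolding finitely_many_cp_expansions_def by (rule finite_subset) simp
qed

end

section \<open>A single factor of maximal order\<close>

text \<open>Functions modulo \<open>N\<close> of degree less than \<open>n\<close>, in the sense that all \<open>n\<close>-fold differences vanish.
  Unlike the degree of a polynomial expression, this notion depends on the function only.\<close>

primrec deg_below :: "int \<Rightarrow> nat \<Rightarrow> ((nat \<Rightarrow> int) \<Rightarrow> int) \<Rightarrow> bool" where
  "deg_below N 0 q \<longleftrightarrow> (\<forall>x. N dvd q x)"
| "deg_below N (Suc n) q \<longleftrightarrow> (\<forall>a. deg_below N n (\<lambda>x. q (\<lambda>j. x j + a j) - q x))"

lemma deg_below_cong:
  assumes "deg_below N n q" "\<And>x. [q x = q' x] (mod N)"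
  shows "deg_below N n q'"
  using assms
proof (induction n arbitrary: q q')
  case 0
  then show ?case by simp (metis cong_0_iff cong_sym cong_trans)
next
  case (Suc n)
  show ?case
    unfolding deg_below.simps
  proof
    fix a
    show "deg_below N n (\<lambda>x. q' (\<lambda>j. x j + a j) - q' x)"
      by (rule Suc.IH[of "\<lambda>x. q (\<lambda>j. x j + a j) - q x"])
        (use Suc.prems in \<open>auto intro: cong_diff\<close>)
  qed
qed

lemma deg_below_zero: "deg_below N n (\<lambda>x. 0)"
  by (induction n) simp_all

lemma deg_below_const: "deg_below N (Suc n) (\<lambda>x. c)"
  by (simp add: deg_below_zero)

lemma deg_below_add:
  "deg_below N n q \<Longrightarrow> deg_below N n q' \<Longrightarrow> deg_below N n (\<lambda>x. q x + q' x)"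
proof (induction n arbitrary: q q')
  case 0
  then show ?case by simp
next
  case (Suc n)
  show ?case
    unfolding deg_below.simps
  proof
    fix a
    have "deg_below N n (\<lambda>x. (q (\<lambda>j. x j + a j) - q x) + (q' (\<lambda>j. x j + a j) - q' x))"
      by (rule Suc.IH) (use Suc.prems in auto)
    then show "deg_below N n (\<lambda>x. q (\<lambda>j. x j + a j) + q' (\<lambda>j. x j + a j) - (q x + q' x))"
      by (simp add: algebra_simps)
  qed
qed

lemma deg_below_scale: "deg_below N n q \<Longrightarrow> deg_below N n (\<lambda>x. c * q x)"
proof (induction n arbitrary: q)
  case 0
  then show ?case by simp
next
  case (Suc n)
  then show ?case by (simp flip: right_diff_distrib)
qed

text \<open>Serves to compare degrees in the large cyclic factor: a function modulo \<open>p\<close>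
  enters there multiplied by \<open>c\<close> and is read modulo \<open>p * c\<close>.\<close>

lemma deg_below_mult_modulus: "deg_below N n q \<Longrightarrow> deg_below (N * c) n (\<lambda>x. c * q x)"
proof (induction n arbitrary: q)
  case 0
  then show ?case by (simp add: mult.commute)
next
  case (Suc n)
  then show ?case by (simp flip: right_diff_distrib)
qed

lemma deg_below_Suc: "deg_below N n q \<Longrightarrow> deg_below N (Suc n) q"
proof (induction n arbitrary: q)
  case (Suc n)
  then have "deg_below N (Suc n) (\<lambda>x. q (\<lambda>j. x j + a j) - q x)" for a
    by (intro Suc.IH) simp
  then show ?case by (subst deg_below.simps) blast
qed simp

text \<open>A shift of \<open>x\<close> by \<open>a\<close> shifts the substituted arguments by the
  constants \<open>L j a\<close>, so differences of the composite are composites of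
  differences.\<close>

lemma deg_below_affine_subst:
  assumes "deg_below N n q" and L: "\<And>j x a. L j (\<lambda>l. x l + a l) = L j x + L j a"
  shows "deg_below N n (\<lambda>x. q (\<lambda>j. b j + L j x))"
  using assms(1)
proof (induction n arbitrary: q)
  case 0
  then show ?case by simp
next
  case (Suc n)
  show ?case
    unfolding deg_below.simps
  proof
    fix a
    have "deg_below N n (\<lambda>x. q (\<lambda>j. (b j + L j x) + L j a) - q (\<lambda>j. b j + L j x))"
      using Suc.IH[of "\<lambda>y. q (\<lambda>j. y j + L j a) - q y"] Suc.prems by simp
    then show "deg_below N n (\<lambda>x. q (\<lambda>j. b j + L j (\<lambda>l. x l + a l)) - q (\<lambda>j. b j + L j x))"
      by (simp add: L add.assoc)
  qed
qed

lemma deg_below_linear: "deg_below N (Suc (Suc n)) (\<lambda>x. b + (\<Sum>j<k. c j * x j))"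
proof -
  have "deg_below N (Suc n) (\<lambda>x. (b + (\<Sum>j<k. c j * (x j + a j))) - (b + (\<Sum>j<k. c j * x j)))" for a
    using deg_below_const[of N n "\<Sum>j<k. c j * a j"]
    by (simp add: distrib_left sum.distrib)
  then show ?thesis by (subst deg_below.simps) blast
qed

lemma deg_below_mult_coordinate:
  "deg_below N n q \<Longrightarrow> deg_below N (Suc n) (\<lambda>x. x i * q x)"
proof (induction n arbitrary: q)
  case 0
  then show ?case by simp
next
  case (Suc n)
  show ?case
    unfolding deg_below.simps(2)[of N "Suc n"]
  proof
    fix a
    \<comment> \<open>Discrete product rule: the difference of \<open>x i * q x\<close> is
      \<open>x i\<close> times the difference of \<open>q\<close>, plus \<open>a i\<close> times the
      shifted \<open>q\<close>.\<close>
    have "deg_below N (Suc n) (\<lambda>x. x i * (q (\<lambda>j. x j + a j) - q x))"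
      by (rule Suc.IH[of "\<lambda>x. q (\<lambda>j. x j + a j) - q x"]) (use Suc.prems in simp)
    moreover have "deg_below N (Suc n) (\<lambda>x. q (\<lambda>j. a j + x j))"
      by (rule deg_below_affine_subst[OF Suc.prems]) simp
    then have "deg_below N (Suc n) (\<lambda>x. a i * q (\<lambda>j. x j + a j))"
      by (intro deg_below_scale) (simp add: add.commute)
    ultimately have "deg_below N (Suc n) (\<lambda>x. x i * (q (\<lambda>j. x j + a j) - q x) + a i * q (\<lambda>j. x j + a j))"
      by (rule deg_below_add)
    then show "deg_below N (Suc n) (\<lambda>x. (x i + a i) * q (\<lambda>j. x j + a j) - x i * q x)"
      by (simp only: algebra_simps)
  qed
qed

lemma deg_below_prod: "deg_below N (Suc n) (\<lambda>x. \<Prod>j<n. x j)"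
proof (induction n)
  case 0
  show ?case by (simp add: deg_below_const)
next
  case (Suc n)
  from deg_below_mult_coordinate[OF this, of n] show ?case by (simp add: mult.commute)
qed

text \<open>Differencing along the unit vectors strips off one factor at a time, from the last to
  the first, until the constant \<open>c\<close> remains.\<close>

lemma not_deg_below_prod: "\<not> N dvd c \<Longrightarrow> \<not> deg_below N n (\<lambda>x. c * (\<Prod>j<n. x j))"
proof (induction n)
  case 0
  then show ?case by simp
next
  case (Suc n)
  define e :: "nat \<Rightarrow> int" where "e j = (if j = n then 1 else 0)" for j
  have "(\<Prod>j<n. x j + e j) = (\<Prod>j<n. x j)" for x :: "nat \<Rightarrow> int"
    by (rule prod.cong) (auto simp: e_def)
  then have "c * (\<Prod>j<Suc n. x j + e j) - c * (\<Prod>j<Suc n. x j) = c * (\<Prod>j<n. x j)" for x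
    by (simp add: e_def algebra_simps)
  then have eq: "(\<lambda>x. c * (\<Prod>j<Suc n. x j + e j) - c * (\<Prod>j<Suc n. x j)) = (\<lambda>x. c * (\<Prod>j<n. x j))"
    by (rule ext)
  show ?case
  proof
    assume "deg_below N (Suc n) (\<lambda>x. c * (\<Prod>j<Suc n. x j))"
    then have "deg_below N n (\<lambda>x. c * (\<Prod>j<Suc n. x j + e j) - c * (\<Prod>j<Suc n. x j))"
      by (simp only: deg_below.simps)
    then show False using Suc unfolding eq by blast
  qed
qed

section \<open>The clone of congruence preserving operations\<close>

context residue_product
begin

lemma Comp_clone_over: "clone_over I M (Comp A ops)"
proof
  show "is_clone A (Comp A ops)"
    unfolding is_clone_def
  proof (intro conjI allI impI)
    show "Comp A ops \<subseteq> operations A" by (auto simp: Comp_def)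
  next
    fix n i :: nat assume i: "i < n"
    have "preserves (vop n (\<lambda>X. X i)) \<theta>" if "\<theta> \<in> congruences A ops" for \<theta>
    proof (rule preserves_vop)
      show eq: "equiv A \<theta>" using that by (simp add: congruences_def)
      then have "\<theta> \<subseteq> A \<times> A" by (rule equivE)
      then show "(vec (X i), vec (Y i)) \<in> \<theta>" if "\<And>j. j < n \<Longrightarrow> (X j, Y j) \<in> \<theta>" for X Y
        using that[OF i] by (auto simp: vec_id)
    qed
    then show "projection A n i \<in> Comp A ops"
      unfolding projection_eq_vop[OF i] using i vop_in_operations[of n] by (simp add: Comp_def)
  next
    fix n k f gs
    assume f: "(n, f) \<in> Comp A ops" and k: "1 \<le> k" and len: "length gs = n"
      and gs: "\<forall>g\<in>set gs. (k, g) \<in> Comp A ops"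
    have fA: "f \<in> nlists n A \<rightarrow> A" using f by (auto simp: Comp_def operations_def)
    have gA: "map (\<lambda>g. g xs) gs \<in> nlists n A" if "xs \<in> nlists k A" for xs
    proof (rule nlistsI)
      show "set (map (\<lambda>g. g xs) gs) \<subseteq> A"
        using gs that by (fastforce simp: Comp_def operations_def)
    qed (simp add: len)
    have "superposition A k f gs \<in> operations A"
      using k fA gA by (auto simp: superposition_def operations_def Pi_def)
    moreover have "preserves (superposition A k f gs) \<theta>" if \<theta>: "\<theta> \<in> congruences A ops" for \<theta>
    proof -
      have "equiv A \<theta>" using \<theta> by (simp add: congruences_def)
      then have sub: "\<theta> \<subseteq> A \<times> A" by (rule equivE)
      have pf: "preserves (n, f) \<theta>" and pg: "\<And>g. g \<in> set gs \<Longrightarrow> preserves (k, g) \<theta>"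
        using f gs \<theta> by (auto simp: Comp_def)
      show ?thesis
        unfolding preserves_def superposition_def
      proof (intro allI impI, simp only: fst_conv snd_conv)
        fix xs ys assume lx: "length xs = k" and rel: "list_all2 (\<lambda>x y. (x, y) \<in> \<theta>) xs ys"
        have "xs \<in> nlists k A" "ys \<in> nlists k A"
          using list_all2_nlists[OF sub rel lx] by auto
        moreover have "(f (map (\<lambda>g. g xs) gs), f (map (\<lambda>g. g ys) gs)) \<in> \<theta>"
        proof -
          have "list_all2 (\<lambda>x y. (x, y) \<in> \<theta>) (map (\<lambda>g. g xs) gs) (map (\<lambda>g. g ys) gs)"
            using pg lx rel by (auto simp: list_all2_map1 list_all2_map2 preserves_def list_all2_same)
          then show ?thesis using pf len by (simp add: preserves_def)
        qed
        ultimately show "((\<lambda>xs\<in>nlists k A. f (map (\<lambda>g. g xs) gs)) xs,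
            (\<lambda>xs\<in>nlists k A. f (map (\<lambda>g. g xs) gs)) ys) \<in> \<theta>" by simp
      qed
    qed
    ultimately show "superposition A k f gs \<in> Comp A ops" by (simp add: Comp_def)
  qed
  have "ops \<subseteq> operations A"
    by (auto simp: ops_eq intro: vop_in_operations)
  then show "ops \<subseteq> Comp A ops"
    by (auto simp: Comp_def congruences_def)
  fix n :: nat and a assume a: "1 \<le> n" "a \<in> A"
  have "preserves (vop n (\<lambda>X. a)) \<theta>" if "\<theta> \<in> congruences A ops" for \<theta>
  proof (rule preserves_vop)
    show eq: "equiv A \<theta>" using that by (simp add: congruences_def)
    then have "refl_on A \<theta>" by (rule equivE)
    then show "(vec a, vec a) \<in> \<theta>" by (simp add: refl_on_def)
  qed
  then show "constant_operation A n a \<in> Comp A ops"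
    using a vop_in_operations[of n] by (simp add: Comp_def constant_operation_eq_vop)
qed

end

text \<open>Multiplication by \<open>c\<close> kills every coordinate except \<open>i0\<close> and
  has a subgroup of order \<open>p\<close> as its image there. Since \<open>p\<close> divides
  \<open>c\<close>, the elements of that subgroup are 0 modulo \<open>p\<close> in coordinate
  \<open>i0\<close>.\<close>

locale single_maximal_factor = residue_product +
  fixes p c :: int and i0 :: nat
  assumes i0: "i0 \<in> I" and prime: "prime p" and M_i0: "M i0 = p * c" and p_dvd: "p dvd c"
    and M_dvd: "i \<in> I \<Longrightarrow> i \<noteq> i0 \<Longrightarrow> M i dvd c"
begin

text \<open>The isomorphism from the integers modulo \<open>p\<close> onto the subgroup of order
  \<open>p\<close> in coordinate \<open>i0\<close>.\<close>

definition embed :: "int \<Rightarrow> nat \<Rightarrow> int" where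
  "embed s = (\<lambda>i. if i = i0 then c * s else 0)"

definition depends_mod :: "nat \<Rightarrow> ((nat \<Rightarrow> int) \<Rightarrow> int) \<Rightarrow> bool" where
  "depends_mod k q \<longleftrightarrow> (\<forall>x y. (\<forall>j<k. [x j = y j] (mod p)) \<longrightarrow> [q x = q y] (mod p))"

text \<open>An affine operation plus an embedded function of degree less than \<open>n\<close> over
  the field with \<open>p\<close> elements, applied to the \<open>i0\<close>-coordinates.
  \<open>depends_mod\<close> says that \<open>q\<close> is an integer lift of a function over that
  field.\<close>

definition poly_rep :: "nat \<Rightarrow> nat \<Rightarrow> ((nat \<Rightarrow> nat \<Rightarrow> int) \<Rightarrow> nat \<Rightarrow> int) \<Rightarrow> bool" where
  "poly_rep n k \<phi> \<longleftrightarrow> (\<exists>b a q. depends_mod k q \<and> deg_below p n q \<and>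
     (\<forall>X. veq (\<phi> X) (\<lambda>i. affine k b a X i + embed (q (\<lambda>j. X j i0)) i)))"

definition poly_clone :: "nat \<Rightarrow> (nat \<Rightarrow> int) operation set" where
  "poly_clone n = {vop k \<phi> | k \<phi>. 1 \<le> k \<and> poly_rep n k \<phi>}"

lemma veq_i0: "veq x y \<Longrightarrow> [x i0 = y i0] (mod p)"
  using i0 M_i0 unfolding veq_def by (metis cong_dvd_modulus dvd_triv_left)

lemma veq_embed: "[s = t] (mod p) \<Longrightarrow> veq (embed s) (embed t)"
  using M_i0 by (auto simp: veq_def embed_def cong_iff_dvd_diff mult.commute[of p]
      simp flip: right_diff_distrib)

lemma embed_zero: "embed 0 = (\<lambda>i. 0)"
  by (auto simp: embed_def)

lemma embed_add: "embed (s + t) i = embed s i + embed t i"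
  by (simp add: embed_def algebra_simps)

lemma embed_scale: "embed (s * t) i = s * embed t i"
  by (simp add: embed_def)

lemma depends_modD: "depends_mod k q \<Longrightarrow> (\<And>j. j < k \<Longrightarrow> [x j = y j] (mod p)) \<Longrightarrow> [q x = q y] (mod p)"
  by (simp add: depends_mod_def)

lemma poly_repI:
  assumes "depends_mod k q" "deg_below p n q"
    "\<And>X. veq (\<phi> X) (\<lambda>i. affine k b a X i + embed (q (\<lambda>j. X j i0)) i)"
  shows "poly_rep n k \<phi>"
  using assms unfolding poly_rep_def by blast

lemma poly_rep_affine: "poly_rep n k (affine k b a)"
  by (rule poly_repI[of k "\<lambda>_. 0" _ _ b a]) (simp_all add: depends_mod_def deg_below_zero embed_zero)

lemma poly_rep_const: "poly_rep n k (\<lambda>X. b)"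
proof -
  have "affine k b (\<lambda>_. 0) = (\<lambda>X. b)" by (simp add: affine_def fun_eq_iff)
  then show ?thesis using poly_rep_affine[of n k b "\<lambda>_. 0"] by simp
qed

lemma poly_rep_nth:
  assumes "j < k"
  shows "poly_rep n k (\<lambda>X. X j)"
proof -
  have "affine k (\<lambda>_. 0) (\<lambda>l. if l = j then 1 else 0) X = X j" for X
    using assms by (simp add: affine_def if_distrib[of "\<lambda>x. x * _"] cong: if_cong)
  then show ?thesis using poly_rep_affine[of n k "\<lambda>_. 0" "\<lambda>l. if l = j then 1 else 0"]
    by (simp add: ext[of "affine k (\<lambda>_. 0) (\<lambda>l. if l = j then 1 else 0)" "\<lambda>X. X j"])
qed

lemma poly_rep_add:
  assumes "poly_rep n k \<phi>" "poly_rep n k \<psi>"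
  shows "poly_rep n k (\<lambda>X i. \<phi> X i + \<psi> X i)"
proof -
  obtain b a q where 1: "depends_mod k q" "deg_below p n q"
    "\<And>X. veq (\<phi> X) (\<lambda>i. affine k b a X i + embed (q (\<lambda>j. X j i0)) i)"
    using assms(1) unfolding poly_rep_def by blast
  obtain b' a' q' where 2: "depends_mod k q'" "deg_below p n q'"
    "\<And>X. veq (\<psi> X) (\<lambda>i. affine k b' a' X i + embed (q' (\<lambda>j. X j i0)) i)"
    using assms(2) unfolding poly_rep_def by blast
  show ?thesis
  proof (rule poly_repI)
    show "depends_mod k (\<lambda>x. q x + q' x)"
      using 1(1) 2(1) by (auto simp: depends_mod_def intro: cong_add)
    show "deg_below p n (\<lambda>x. q x + q' x)"
      using 1(2) 2(2) by (rule deg_below_add)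
    show "veq (\<lambda>i. \<phi> X i + \<psi> X i) (\<lambda>i. affine k (\<lambda>i. b i + b' i) (\<lambda>j. a j + a' j) X i +
        embed (q (\<lambda>j. X j i0) + q' (\<lambda>j. X j i0)) i)" for X
      using veq_add[OF 1(3) 2(3), of X X]
      by (simp add: affine_def embed_add distrib_right sum.distrib algebra_simps)
  qed
qed

lemma poly_rep_scale:
  assumes "poly_rep n k \<phi>"
  shows "poly_rep n k (\<lambda>X i. s * \<phi> X i)"
proof -
  obtain b a q where 1: "depends_mod k q" "deg_below p n q"
    "\<And>X. veq (\<phi> X) (\<lambda>i. affine k b a X i + embed (q (\<lambda>j. X j i0)) i)"
    using assms(1) unfolding poly_rep_def by blast
  show ?thesis
  proof (rule poly_repI)
    show "depends_mod k (\<lambda>x. s * q x)"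
      using 1(1) by (auto simp: depends_mod_def intro: cong_scalar_left)
    show "deg_below p n (\<lambda>x. s * q x)"
      using 1(2) by (rule deg_below_scale)
    show "veq (\<lambda>i. s * \<phi> X i) (\<lambda>i. affine k (\<lambda>i. s * b i) (\<lambda>j. s * a j) X i +
        embed (s * q (\<lambda>j. X j i0)) i)" for X
      using veq_scale[OF 1(3), of s X]
      by (simp add: affine_def embed_scale distrib_left sum_distrib_left mult.assoc)
  qed
qed

lemma poly_rep_sum:
  fixes l :: nat
  shows "(\<And>j. j < l \<Longrightarrow> poly_rep n k (\<phi> j)) \<Longrightarrow> poly_rep n k (\<lambda>X i. \<Sum>j<l. \<phi> j X i)"
proof (induction l)
  case 0
  show ?case using poly_rep_const[of n k "\<lambda>_. 0"] by simp
next
  case (Suc l)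
  then show ?case using poly_rep_add[of n k "\<lambda>X i. \<Sum>j<l. \<phi> j X i" "\<phi> l"] by simp
qed

text \<open>The reason for bounding degrees: an embedded value is 0 modulo \<open>p\<close> in
  coordinate \<open>i0\<close>, so modulo \<open>p\<close> the inner functions are affine there, and
  an affine substitution does not raise the degree of \<open>q\<close>.\<close>

lemma poly_rep_embed:
  assumes q: "depends_mod l q" "deg_below p n q" and \<phi>: "\<And>j. j < l \<Longrightarrow> poly_rep n k (\<phi> j)"
  shows "poly_rep n k (\<lambda>X. embed (q (\<lambda>j. \<phi> j X i0)))"
proof -
  have "\<exists>b a. \<forall>X. [\<phi> j X i0 = b + (\<Sum>l<k. a l * X l i0)] (mod p)" if j: "j < l" for j
  proof -
    obtain b a q' where "\<And>X. veq (\<phi> j X) (\<lambda>i. affine k b a X i + embed (q' (\<lambda>j. X j i0)) i)"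
      using \<phi>[OF j] unfolding poly_rep_def by blast
    then have *: "[\<phi> j X i0 = affine k b a X i0 + embed (q' (\<lambda>j. X j i0)) i0] (mod p)" for X
      by (rule veq_i0)
    have "[affine k b a X i0 + embed (q' (\<lambda>j. X j i0)) i0 = affine k b a X i0 + 0] (mod p)" for X
      using p_dvd by (intro cong_add) (simp_all add: embed_def cong_0_iff)
    from cong_trans[OF * this] show ?thesis by (auto simp: affine_def)
  qed
  then obtain b a where ba:
    "\<And>j X. j < l \<Longrightarrow> [\<phi> j X i0 = b j + (\<Sum>l<k. a j l * X l i0)] (mod p)"
    by metis
  let ?q = "\<lambda>x. q (\<lambda>j. b j + (\<Sum>l<k. a j l * x l))"
  show ?thesis
  proof (rule poly_repI)
    show "depends_mod k ?q"
      unfolding depends_mod_def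
      by (intro allI impI depends_modD[OF q(1)] cong_add cong_refl cong_sum cong_scalar_left) auto
    show "deg_below p n ?q"
      by (rule deg_below_affine_subst[OF q(2)]) (simp add: distrib_left sum.distrib)
    show "veq (embed (q (\<lambda>j. \<phi> j X i0)))
        (\<lambda>i. affine k (\<lambda>_. 0) (\<lambda>_. 0) X i + embed (?q (\<lambda>j. X j i0)) i)" for X
      using veq_embed[OF depends_modD[OF q(1) ba]] by (simp add: affine_def)
  qed
qed

lemma poly_cloneI: "1 \<le> k \<Longrightarrow> poly_rep n k \<phi> \<Longrightarrow> vop k \<phi> \<in> poly_clone n"
  unfolding poly_clone_def by blast

text \<open>In a superposition the outer affine part yields a linear combination of the inner
  functions, and the outer embedded part is covered by \<open>poly_rep_embed\<close>.\<close>

lemma poly_clone_is_clone: "is_clone A (poly_clone n)"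
  unfolding is_clone_def
proof (intro conjI allI impI)
  show "poly_clone n \<subseteq> operations A"
    by (auto simp: poly_clone_def vop_in_operations)
next
  fix k i :: nat assume i: "i < k"
  then show "projection A k i \<in> poly_clone n"
    unfolding projection_eq_vop[OF i] by (intro poly_cloneI poly_rep_nth) auto
next
  fix l k f gs
  assume f: "(l, f) \<in> poly_clone n" and k: "1 \<le> k" and len: "length gs = l"
    and gs: "\<forall>g\<in>set gs. (k, g) \<in> poly_clone n"
  obtain \<phi> where \<phi>: "(l, f) = vop l \<phi>" "poly_rep n l \<phi>"
    using f unfolding poly_clone_def by (auto simp: vop_def)
  obtain b a q where q: "depends_mod l q" "deg_below p n q"
    "\<And>X. veq (\<phi> X) (\<lambda>i. affine l b a X i + embed (q (\<lambda>j. X j i0)) i)"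
    using \<phi>(2) unfolding poly_rep_def by blast
  have "\<exists>\<psi>. (k, gs ! j) = vop k \<psi> \<and> poly_rep n k \<psi>" if "j < l" for j
  proof -
    have "(k, gs ! j) \<in> poly_clone n" using gs len that by simp
    then show ?thesis unfolding poly_clone_def by (auto simp: vop_def)
  qed
  then obtain \<psi> where \<psi>: "\<And>j. j < l \<Longrightarrow> (k, gs ! j) = vop k (\<psi> j)" "\<And>j. j < l \<Longrightarrow> poly_rep n k (\<psi> j)"
    by metis
  define \<chi> where "\<chi> X = (\<lambda>i. affine l b a (\<lambda>j. \<psi> j X) i + embed (q (\<lambda>j. \<psi> j X i0)) i)" for X
  have "poly_rep n k \<chi>"
    unfolding \<chi>_def affine_def
    by (intro poly_rep_add poly_rep_const poly_rep_sum poly_rep_scale poly_rep_embed[OF q(1,2)] \<psi>(2))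
  moreover have "superposition A k f gs = vop k \<chi>"
  proof -
    have "f (map (\<lambda>g. g xs) gs) = vec (\<chi> ((!) xs))" if xs: "xs \<in> nlists k A" for xs
    proof -
      let ?ys = "map (\<lambda>g. g xs) gs"
      have nth: "?ys ! j = vec (\<psi> j ((!) xs))" if j: "j < l" for j
        using j len snd_vop[OF xs, of "\<psi> j"] \<psi>(1)[OF j, symmetric] by simp
      then have "?ys = map (\<lambda>j. vec (\<psi> j ((!) xs))) [0..<l]"
        by (intro nth_equalityI) (simp_all add: len)
      then have "?ys \<in> nlists l A" using map_vec_in_nlists by metis
      then have "f ?ys = vec (\<phi> ((!) ?ys))"
        using snd_vop[of ?ys l \<phi>] \<phi>(1)[symmetric] by simp
      also have "veq (\<phi> ((!) ?ys)) (\<chi> ((!) xs))"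
        unfolding \<chi>_def
      proof (rule veq_trans[OF q(3)], intro veq_add veq_affine veq_embed depends_modD[OF q(1)])
        show "veq (?ys ! j) (\<psi> j ((!) xs))" if "j < l" for j
          unfolding nth[OF that] by (rule veq_vec)
        then show "[(?ys ! j) i0 = \<psi> j ((!) xs) i0] (mod p)" if "j < l" for j
          using that veq_i0 by blast
      qed
      then have "vec (\<phi> ((!) ?ys)) = vec (\<chi> ((!) xs))" by (simp only: vec_eq_iff)
      finally show ?thesis .
    qed
    then show ?thesis by (auto simp: superposition_def vop_def intro!: restrict_ext)
  qed
  ultimately show "superposition A k f gs \<in> poly_clone n"
    using k unfolding poly_clone_def by blast
qed

lemma Pol_subset_poly_clone: "Pol A ops \<subseteq> poly_clone n"
proof (rule Pol_subset[OF poly_clone_is_clone])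
  have "vop 2 (\<lambda>X i. X 0 i + X 1 i) \<in> poly_clone n"
    by (intro poly_cloneI poly_rep_add poly_rep_nth) auto
  moreover have "vop 1 (\<lambda>X i. (- 1) * X 0 i) \<in> poly_clone n"
    by (intro poly_cloneI poly_rep_scale poly_rep_nth) auto
  moreover have "vop 1 (\<lambda>X i. 0) \<in> poly_clone n"
    by (intro poly_cloneI poly_rep_const) simp
  ultimately show "ops \<subseteq> poly_clone n"
    by (simp add: ops_eq)
next
  fix k :: nat and a assume "1 \<le> k" "a \<in> A"
  then show "constant_operation A k a \<in> poly_clone n"
    by (simp only: constant_operation_eq_vop) (intro poly_cloneI poly_rep_const)
qed

text \<open>If all arguments agree modulo \<open>p\<close> in coordinate \<open>i0\<close>, the two
  values coincide. Otherwise some difference \<open>X j - Y j\<close> is invertible there, and a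
  unary affine map carries \<open>X j\<close> and \<open>Y j\<close> to the two values, which are
  therefore congruent.\<close>

lemma vop_embed_in_Comp:
  assumes k: "1 \<le> k" and q: "depends_mod k q"
  shows "vop k (\<lambda>X. embed (q (\<lambda>j. X j i0))) \<in> Comp A ops"
proof -
  interpret Comp: clone_over I M "Comp A ops" by (rule Comp_clone_over)
  have "preserves (vop k (\<lambda>X. embed (q (\<lambda>j. X j i0)))) \<theta>" if \<theta>: "\<theta> \<in> congruences A ops" for \<theta>
  proof (rule preserves_vop)
    show eq: "equiv A \<theta>" using \<theta> by (simp add: congruences_def)
    fix X Y :: "nat \<Rightarrow> nat \<Rightarrow> int"
    assume XY: "\<And>j. j < k \<Longrightarrow> (X j, Y j) \<in> \<theta>"
    let ?s = "q (\<lambda>j. X j i0)" and ?t = "q (\<lambda>j. Y j i0)"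
    show "(vec (embed ?s), vec (embed ?t)) \<in> \<theta>"
    proof (cases "\<forall>j<k. [X j i0 = Y j i0] (mod p)")
      case True
      then have "veq (embed ?s) (embed ?t)"
        by (intro veq_embed depends_modD[OF q]) auto
      then have "vec (embed ?s) = vec (embed ?t)" by (simp only: vec_eq_iff)
      moreover have "refl_on A \<theta>" using eq by (rule equivE)
      ultimately show ?thesis by (simp add: refl_on_def)
    next
      case False
      then obtain j where j: "j < k" "\<not> [X j i0 = Y j i0] (mod p)" by blast
      then have "coprime (X j i0 - Y j i0) p"
        using prime by (metis cong_iff_dvd_diff coprime_commute prime_imp_coprime)
      then obtain u where u: "[(X j i0 - Y j i0) * u = 1] (mod p)"
        using cong_solve_coprime_int by blast
      \<comment> \<open>\<open>u\<close> inverts the difference modulo \<open>p\<close>, so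
        \<open>c * d\<close> times \<open>X j - Y j\<close> is \<open>embed (?s - ?t)\<close> in the
        group; the constant \<open>b\<close> makes the map send \<open>Y j\<close> to
        \<open>embed ?t\<close>.\<close>
      define d where "d = u * (?s - ?t)"
      define b where "b = (\<lambda>i. embed ?t i - c * d * Y j i)"
      have "vop 1 (affine 1 b (\<lambda>_. c * d)) \<in> Comp A ops" by (rule Comp.vop_affine) simp
      then have "preserves (vop 1 (affine 1 b (\<lambda>_. c * d))) \<theta>" using \<theta> by (simp add: Comp_def)
      then have "(snd (vop 1 (affine 1 b (\<lambda>_. c * d))) [X j], snd (vop 1 (affine 1 b (\<lambda>_. c * d))) [Y j]) \<in> \<theta>"
        using XY[OF j(1)] by (simp add: preserves_def)
      moreover have "[X j] \<in> nlists 1 A" "[Y j] \<in> nlists 1 A"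
        using XY[OF j(1)] equivE[OF eq] by (auto intro!: nlistsI)
      ultimately have "(vec (affine 1 b (\<lambda>_. c * d) ((!) [X j])), vec (affine 1 b (\<lambda>_. c * d) ((!) [Y j]))) \<in> \<theta>"
        by (simp only: snd_vop)
      moreover have "affine 1 b (\<lambda>_. c * d) ((!) [Y j]) = embed ?t"
        by (simp add: affine_def b_def)
      moreover have "veq (affine 1 b (\<lambda>_. c * d) ((!) [X j])) (embed ?s)"
        unfolding veq_def
      proof
        fix i assume i: "i \<in> I"
        show "[affine 1 b (\<lambda>_. c * d) ((!) [X j]) i = embed ?s i] (mod M i)"
        proof (cases "i = i0")
          case True
          have "[(X j i0 - Y j i0) * u * (?s - ?t) = 1 * (?s - ?t)] (mod p)"
            by (rule cong_scalar_right[OF u])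
          then have "p dvd (X j i0 - Y j i0) * u * (?s - ?t) - (?s - ?t)"
            by (simp add: cong_iff_dvd_diff)
          then have "p * c dvd ((X j i0 - Y j i0) * u * (?s - ?t) - (?s - ?t)) * c"
            by (rule mult_dvd_mono) simp
          then show ?thesis
            unfolding True M_i0 cong_iff_dvd_diff
            by (simp add: affine_def b_def embed_def d_def algebra_simps)
        next
          case False
          then show ?thesis
            using M_dvd[OF i False] by (simp add: affine_def b_def embed_def cong_iff_dvd_diff
              mult.assoc flip: right_diff_distrib)
        qed
      qed
      ultimately show ?thesis by (simp only: vec_eq_iff[symmetric])
    qed
  qed
  then show ?thesis using vop_in_operations[OF k] by (simp add: Comp_def)
qed

lemma poly_clone_subset_Comp: "poly_clone n \<subseteq> Comp A ops"
proof -
  interpret Comp: clone_over I M "Comp A ops" by (rule Comp_clone_over)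
  have "vop k \<phi> \<in> Comp A ops" if k: "1 \<le> k" and \<phi>: "poly_rep n k \<phi>" for k \<phi>
  proof -
    obtain b a q where q: "depends_mod k q"
      "\<And>X. veq (\<phi> X) (\<lambda>i. affine k b a X i + embed (q (\<lambda>j. X j i0)) i)"
      using \<phi> unfolding poly_rep_def by blast
    have "vop k \<phi> = vop k (\<lambda>X i. affine k b a X i + embed (q (\<lambda>j. X j i0)) i)"
      by (rule vop_eqI) (rule q(2))
    moreover have "vop k (\<lambda>X i. affine k b a X i + embed (q (\<lambda>j. X j i0)) i) \<in> Comp A ops"
      by (intro Comp.vop_add k Comp.vop_affine vop_embed_in_Comp q(1))
    ultimately show ?thesis by simp
  qed
  then show ?thesis by (auto simp: poly_clone_def)
qed

section \<open>Strictness of the chain of clones\<close>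

definition prod_op :: "nat \<Rightarrow> (nat \<Rightarrow> int) operation" where
  "prod_op n = vop n (\<lambda>X. embed (\<Prod>j<n. X j i0))"

lemma poly_clone_mono: "n \<le> n' \<Longrightarrow> poly_clone n \<subseteq> poly_clone n'"
proof (rule lift_Suc_mono_le)
  show "poly_clone n \<subseteq> poly_clone (Suc n)" for n
    unfolding poly_clone_def poly_rep_def using deg_below_Suc by blast
qed

lemma prod_op_in: "1 \<le> n \<Longrightarrow> prod_op n \<in> poly_clone (Suc n)"
proof -
  assume n: "1 \<le> n"
  have "poly_rep (Suc n) n (\<lambda>X. embed (\<Prod>j<n. X j i0))"
  proof (rule poly_repI)
    show "depends_mod n (\<lambda>x. \<Prod>j<n. x j)" by (auto simp: depends_mod_def intro: cong_prod)
    show "deg_below p (Suc n) (\<lambda>x. \<Prod>j<n. x j)" by (rule deg_below_prod)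
    show "veq (embed (\<Prod>j<n. X j i0))
        (\<lambda>i. affine n (\<lambda>_. 0) (\<lambda>_. 0) X i + embed (\<Prod>j<n. X j i0) i)" for X
      by (simp add: affine_def)
  qed
  then show ?thesis using n unfolding poly_clone_def prod_op_def by blast
qed

text \<open>Coordinate \<open>i0\<close> of a representation would express \<open>c\<close> times
  the product of \<open>n\<close> variables, modulo \<open>p * c\<close>, by a function of degree
  less than \<open>n\<close>. Degree depends on the function only, so this contradicts
  \<open>not_deg_below_prod\<close>.\<close>

lemma prod_op_notin:
  assumes n: "2 \<le> n"
  shows "prod_op n \<notin> poly_clone n"
proof
  assume "prod_op n \<in> poly_clone n"
  then obtain \<phi> where eq: "prod_op n = vop n \<phi>" and \<phi>: "poly_rep n n \<phi>"
    by (auto simp: poly_clone_def prod_op_def vop_def)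
  obtain b a q where q: "depends_mod n q" "deg_below p n q"
    "\<And>X. veq (\<phi> X) (\<lambda>i. affine n b a X i + embed (q (\<lambda>j. X j i0)) i)"
    using \<phi> unfolding poly_rep_def by blast
  have "[(b i0 + (\<Sum>j<n. a j * x j)) + c * q x = c * (\<Prod>j<n. x j)] (mod p * c)" for x
  proof -
    \<comment> \<open>Constant vectors realise arbitrary integers as \<open>i0\<close>-coordinates
      of the arguments, up to congruence.\<close>
    let ?xs = "map (\<lambda>j. vec (\<lambda>_. x j)) [0..<n]"
    have nth: "veq (?xs ! j) (\<lambda>_. x j)" if "j < n" for j using that by simp
    have resp: "depends_mod n (\<lambda>x. \<Prod>j<n. x j)"
      by (auto simp: depends_mod_def intro: cong_prod)
    have "vec (embed (\<Prod>j<n. (?xs ! j) i0)) = vec (\<phi> ((!) ?xs))"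
      using arg_cong[OF eq, of "\<lambda>h. snd h ?xs"] unfolding prod_op_def
      by (simp only: snd_vop[OF map_vec_in_nlists])
    then have "veq (\<phi> ((!) ?xs)) (embed (\<Prod>j<n. (?xs ! j) i0))"
      by (simp only: vec_eq_iff veq_sym)
    also have "veq (embed (\<Prod>j<n. (?xs ! j) i0)) (embed (\<Prod>j<n. x j))"
      by (rule veq_embed[OF depends_modD[OF resp]]) (rule veq_i0[OF nth])
    finally have "veq (\<lambda>i. affine n b a ((!) ?xs) i + embed (q (\<lambda>j. (?xs ! j) i0)) i) (embed (\<Prod>j<n. x j))"
      by (rule veq_trans[OF veq_sym[OF q(3)]])
    moreover have "veq (\<lambda>i. affine n b a (\<lambda>j _. x j) i + embed (q x) i)
        (\<lambda>i. affine n b a ((!) ?xs) i + embed (q (\<lambda>j. (?xs ! j) i0)) i)"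
      by (intro veq_add veq_affine veq_sym[OF nth] veq_embed depends_modD[OF q(1)]
          cong_sym[OF veq_i0[OF nth]])
    ultimately have "veq (\<lambda>i. affine n b a (\<lambda>j _. x j) i + embed (q x) i) (embed (\<Prod>j<n. x j))"
      by (rule veq_trans[rotated])
    then show ?thesis using i0 by (auto simp: veq_def M_i0 affine_def embed_def)
  qed
  moreover have "deg_below (p * c) n (\<lambda>x. (b i0 + (\<Sum>j<n. a j * x j)) + c * q x)"
  proof -
    \<comment> \<open>The affine part may have degree 1, hence the bound
      \<open>2 \<le> n\<close>.\<close>
    obtain n' where n': "n = Suc (Suc n')" using n by (metis add_2_eq_Suc le_Suc_ex)
    have "deg_below (p * c) n (\<lambda>x. b i0 + (\<Sum>j<n. a j * x j))"
      unfolding n' by (rule deg_below_linear)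
    then show ?thesis
      by (rule deg_below_add) (rule deg_below_mult_modulus[OF q(2)])
  qed
  ultimately have "deg_below (p * c) n (\<lambda>x. c * (\<Prod>j<n. x j))"
    by (rule deg_below_cong[rotated])
  moreover have "\<not> p * c dvd c"
  proof -
    have "c \<noteq> 0" using M_pos[OF i0] M_i0 by auto
    then show ?thesis using prime_gt_1_int[OF prime] by simp
  qed
  ultimately show False using not_deg_below_prod by blast
qed

lemma infinitely_many_expansions: "\<not> finitely_many_cp_expansions A ops"
proof -
  have "poly_clone n \<noteq> poly_clone n'" if "2 \<le> n" "n < n'" for n n'
    using prod_op_in[of n] prod_op_notin[of n] poly_clone_mono[of "Suc n" n'] that by auto
  then have "inj_on poly_clone {2..}"
    by (intro inj_onI) (metis atLeast_iff linorder_neqE_nat)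
  then have "infinite (poly_clone ` {2..})"
    using finite_imageD infinite_Ici by blast
  moreover have "poly_clone ` {2..} \<subseteq> {C. is_clone A C \<and> Pol A ops \<subseteq> C \<and> C \<subseteq> Comp A ops}"
    by (intro image_subsetI CollectI conjI poly_clone_is_clone Pol_subset_poly_clone poly_clone_subset_Comp)
  ultimately show ?thesis
    unfolding finitely_many_cp_expansions_def using finite_subset by blast
qed

end

section \<open>Cyclic groups of prime order\<close>

lemma prime_cong_inverse:
  fixes p a :: int
  assumes "prime p" "\<not> [a = 0] (mod p)"
  obtains b where "[b * a = 1] (mod p)"
proof -
  have "coprime a p"
    using assms by (metis cong_0_iff coprime_commute prime_imp_coprime)
  then obtain b where "[a * b = 1] (mod p)" using cong_solve_coprime_int by blast
  then show ?thesis using that by (simp add: mult.commute)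
qed

text \<open>Subtracting the value at 0 leaves an additive function modulo \<open>p\<close>; it is
  linear, with its values at the unit vectors as coefficients.\<close>

lemma additive_mod_imp_affine:
  fixes p :: int and \<phi> :: "(nat \<Rightarrow> int) \<Rightarrow> int"
  assumes p: "0 < p"
    and resp: "\<And>x y. (\<And>j. j < k \<Longrightarrow> [x j = y j] (mod p)) \<Longrightarrow> \<phi> x = \<phi> y"
    and add: "\<And>a b. [\<phi> (\<lambda>j. a j + b j) + \<phi> (\<lambda>_. 0) = \<phi> a + \<phi> b] (mod p)"
  shows "\<exists>c. \<forall>x. [\<phi> x = \<phi> (\<lambda>_. 0) + (\<Sum>j<k. c j * x j)] (mod p)"
proof -
  define \<psi> where "\<psi> x = \<phi> x - \<phi> (\<lambda>_. 0)" for x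
  have \<psi>_add: "[\<psi> (\<lambda>j. a j + b j) = \<psi> a + \<psi> b] (mod p)" for a b
    using add[of a b] by (simp add: \<psi>_def cong_iff_dvd_diff algebra_simps)
  have \<psi>0: "\<psi> (\<lambda>_. 0) = 0" by (simp add: \<psi>_def)
  have \<psi>_resp: "\<psi> x = \<psi> y" if "\<And>j. j < k \<Longrightarrow> [x j = y j] (mod p)" for x y
    unfolding \<psi>_def using resp that by metis
  define e :: "nat \<Rightarrow> int \<Rightarrow> nat \<Rightarrow> int" where "e j s l = (if l = j then s else 0)" for j s l
  have nat: "[\<psi> (e j (int n)) = int n * \<psi> (e j 1)] (mod p)" for j n
  proof (induction n)
    case 0
    have "e j 0 = (\<lambda>_. 0)" by (auto simp: e_def)
    then show ?case using \<psi>0 by simp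
  next
    case (Suc n)
    have "e j (int (Suc n)) = (\<lambda>l. e j (int n) l + e j 1 l)" by (auto simp: e_def)
    then have "[\<psi> (e j (int (Suc n))) = \<psi> (e j (int n)) + \<psi> (e j 1)] (mod p)"
      using \<psi>_add by simp
    also have "[\<psi> (e j (int n)) + \<psi> (e j 1) = int n * \<psi> (e j 1) + \<psi> (e j 1)] (mod p)"
      by (intro cong_add Suc cong_refl)
    finally show ?case by (simp add: algebra_simps)
  qed
  have scale: "[\<psi> (e j s) = \<psi> (e j 1) * s] (mod p)" for j s
  proof -
    \<comment> \<open>Induction on additivity reaches natural multiples only, so \<open>s\<close> is
      replaced by its natural residue.\<close>
    have s: "[int (nat (s mod p)) = s] (mod p)" using p by (simp add: cong_def)
    have "\<psi> (e j s) = \<psi> (e j (int (nat (s mod p))))"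
      using p by (intro \<psi>_resp) (simp add: e_def cong_sym[OF s] cong_def)
    also have "[\<dots> = int (nat (s mod p)) * \<psi> (e j 1)] (mod p)" by (rule nat)
    also have "[int (nat (s mod p)) * \<psi> (e j 1) = s * \<psi> (e j 1)] (mod p)"
      by (rule cong_scalar_right[OF s])
    finally show ?thesis by (simp add: mult.commute)
  qed
  have sum: "[\<psi> (\<lambda>l. if l < n then x l else 0) = (\<Sum>j<n. \<psi> (e j 1) * x j)] (mod p)" for n x
  proof (induction n)
    case 0
    show ?case using \<psi>0 by simp
  next
    case (Suc n)
    have "(\<lambda>l. if l < Suc n then x l else 0) = (\<lambda>l. (if l < n then x l else 0) + e n (x n) l)"
      by (auto simp: e_def fun_eq_iff)
    then have "[\<psi> (\<lambda>l. if l < Suc n then x l else 0)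
        = \<psi> (\<lambda>l. if l < n then x l else 0) + \<psi> (e n (x n))] (mod p)"
      using \<psi>_add by simp
    also have "[\<psi> (\<lambda>l. if l < n then x l else 0) + \<psi> (e n (x n))
        = (\<Sum>j<n. \<psi> (e j 1) * x j) + \<psi> (e n 1) * x n] (mod p)"
      by (intro cong_add Suc scale)
    finally show ?case by simp
  qed
  have "[\<phi> x = \<phi> (\<lambda>_. 0) + (\<Sum>j<k. \<psi> (e j 1) * x j)] (mod p)" for x
  proof -
    have "\<psi> x = \<psi> (\<lambda>l. if l < k then x l else 0)" by (rule \<psi>_resp) simp
    then have "[\<psi> x = (\<Sum>j<k. \<psi> (e j 1) * x j)] (mod p)" using sum by simp
    then have "[\<phi> (\<lambda>_. 0) + \<psi> x = \<phi> (\<lambda>_. 0) + (\<Sum>j<k. \<psi> (e j 1) * x j)] (mod p)"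
      by (intro cong_add cong_refl)
    then show ?thesis by (simp add: \<psi>_def)
  qed
  then show ?thesis by (intro exI[of _ "\<lambda>j. \<psi> (e j 1)"] allI)
qed

section \<open>Interpolation in clones over a prime field\<close>

locale clone_over_prime_field = clone_over +
  assumes I: "I = {1}" and prime: "prime (M 1)"
begin

lemma veq_iff: "veq x y \<longleftrightarrow> [x 1 = y 1] (mod M 1)"
  unfolding veq_def by (simp add: I)

text \<open>The operation \<open>g\<close> acts as a conjunction: it vanishes as soon as one
  argument does, and not at (1,1). It joins the function already found for \<open>T\<close> with an
  affine one that is 1 at \<open>y\<close> and 0 at the new point \<open>t\<close>.\<close>

lemma interpolation:
  assumes g: "(2, g) \<in> C"
    and zero: "\<And>w w'. veq w (\<lambda>_. 0) \<or> veq w' (\<lambda>_. 0) \<Longrightarrow> veq (g [vec w, vec w']) (\<lambda>_. 0)"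
    and nonzero: "\<not> veq (g [vec (\<lambda>_. 1), vec (\<lambda>_. 1)]) (\<lambda>_. 0)"
    and k: "1 \<le> k" and y: "y \<in> nlists k A"
    and T: "finite T" "T \<subseteq> nlists k A" "y \<notin> T"
  shows "\<exists>\<phi>. vop k \<phi> \<in> C \<and> veq (\<phi> ((!) y)) (\<lambda>_. 1) \<and> (\<forall>z\<in>T. veq (\<phi> ((!) z)) (\<lambda>_. 0))"
  using T
proof (induction T rule: finite_induct)
  case empty
  show ?case using vop_const[OF k, of "\<lambda>_. 1"] by (intro exI[of _ "\<lambda>_ _. 1"]) simp
next
  case (insert t T)
  then obtain \<phi> where \<phi>: "vop k \<phi> \<in> C" "veq (\<phi> ((!) y)) (\<lambda>_. 1)" "\<And>z. z \<in> T \<Longrightarrow> veq (\<phi> ((!) z)) (\<lambda>_. 0)"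
    by blast
  have t: "t \<in> nlists k A" "y \<noteq> t" using insert by auto
  then obtain l where l: "l < k" "y ! l \<noteq> t ! l"
    using y by (metis nlistsE_length nth_equalityI)
  then have "\<not> veq (y ! l) (t ! l)"
    using y t by (metis nlists_nth_vec vec_eq_iff)
  then have "\<not> [(y ! l) 1 - (t ! l) 1 = 0] (mod M 1)"
    by (simp add: veq_iff cong_diff_iff_cong_0)
  then obtain \<beta> where \<beta>: "[\<beta> * ((y ! l) 1 - (t ! l) 1) = 1] (mod M 1)"
    by (rule prime_cong_inverse[OF prime])
  \<comment> \<open>Its inverse \<open>\<kappa>\<close> rescales the value at \<open>y\<close> to 1;
    similarly, \<open>\<beta>\<close> normalises the separating function \<open>sep\<close>.\<close>
  define q where "q = g [vec (\<lambda>_. 1), vec (\<lambda>_. 1)] 1"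
  have "\<not> [q = 0] (mod M 1)" using nonzero by (simp add: veq_iff q_def)
  then obtain \<kappa> where \<kappa>: "[\<kappa> * q = 1] (mod M 1)" by (rule prime_cong_inverse[OF prime])
  define sep where "sep X = (\<lambda>i. \<beta> * X l i + - \<beta> * (t ! l) i)" for X :: "nat \<Rightarrow> nat \<Rightarrow> int"
  have "vop k sep \<in> C"
    unfolding sep_def by (intro vop_add vop_scale vop_const vop_nth k l)
  with \<phi>(1) have "vop k (\<lambda>X. g (map (\<lambda>j. vec ((if j = 0 then \<phi> else sep) X)) [0..<2])) \<in> C"
    by (intro vop_compose[OF g k]) auto
  then have "vop k (\<lambda>X i. \<kappa> * g (map (\<lambda>j. vec ((if j = 0 then \<phi> else sep) X)) [0..<2]) i) \<in> C"
    by (rule vop_scale[OF k])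
  moreover have "map (\<lambda>j. vec ((if j = 0 then \<phi> else sep) X)) [0..<2] = [vec (\<phi> X), vec (sep X)]" for X
    by (simp add: upt_rec)
  ultimately have C: "vop k (\<lambda>X i. \<kappa> * g [vec (\<phi> X), vec (sep X)] i) \<in> C" by simp
  have one: "veq (\<lambda>i. \<kappa> * g [vec (\<phi> ((!) y)), vec (sep ((!) y))] i) (\<lambda>_. 1)"
  proof -
    have "vec (sep ((!) y)) = vec (\<lambda>_. 1)" "vec (\<phi> ((!) y)) = vec (\<lambda>_. 1)"
      using \<beta> \<phi>(2) by (simp_all add: vec_eq_iff veq_iff sep_def algebra_simps)
    then show ?thesis using \<kappa> by (simp add: veq_iff q_def)
  qed
  have zeros: "veq (\<lambda>i. \<kappa> * g [vec (\<phi> ((!) z)), vec (sep ((!) z))] i) (\<lambda>_. 0)"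
    if z: "z \<in> insert t T" for z
  proof -
    have "veq (\<phi> ((!) z)) (\<lambda>_. 0) \<or> veq (sep ((!) z)) (\<lambda>_. 0)"
      using z \<phi>(3) by (auto simp: sep_def)
    then have "veq (g [vec (\<phi> ((!) z)), vec (sep ((!) z))]) (\<lambda>_. 0)" by (rule zero)
    from veq_scale[OF this, of \<kappa>] show ?thesis by simp
  qed
  show ?case
    by (rule exI, intro conjI ballI, rule C, rule one, rule zeros)
qed

lemma finite_nlists: "finite (nlists k A)"
proof -
  have "finite A" unfolding A_eq_PiE by (simp add: finite_PiE I)
  then have "finite {xs. set xs \<subseteq> A \<and> length xs = k}" by (rule finite_lists_length_eq)
  then show ?thesis by (rule rev_finite_subset) (auto dest: nlistsE_set)
qed

text \<open>The tuples over \<open>A\<close> are finite in number, so every operation is the sum of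
  its values times the characteristic functions of points supplied by
  \<open>interpolation\<close>.\<close>

lemma operations_subset:
  assumes g: "(2, g) \<in> C"
    and zero: "\<And>w w'. veq w (\<lambda>_. 0) \<or> veq w' (\<lambda>_. 0) \<Longrightarrow> veq (g [vec w, vec w']) (\<lambda>_. 0)"
    and nonzero: "\<not> veq (g [vec (\<lambda>_. 1), vec (\<lambda>_. 1)]) (\<lambda>_. 0)"
  shows "operations A \<subseteq> C"
proof clarify
  fix k f assume f: "(k, f) \<in> operations A"
  then have k: "1 \<le> k" and fA: "f \<in> nlists k A \<rightarrow>\<^sub>E A" by (auto simp: operations_def)
  have "\<forall>y\<in>nlists k A. \<exists>\<phi>. vop k \<phi> \<in> C \<and> veq (\<phi> ((!) y)) (\<lambda>_. 1) \<and>
      (\<forall>z\<in>nlists k A - {y}. veq (\<phi> ((!) z)) (\<lambda>_. 0))"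
    by (intro ballI interpolation[OF assms k]) (auto intro: finite_nlists)
  then obtain \<Phi> where \<Phi>: "\<And>y. y \<in> nlists k A \<Longrightarrow> vop k (\<Phi> y) \<in> C"
    "\<And>y. y \<in> nlists k A \<Longrightarrow> veq (\<Phi> y ((!) y)) (\<lambda>_. 1)"
    "\<And>y z. y \<in> nlists k A \<Longrightarrow> z \<in> nlists k A \<Longrightarrow> y \<noteq> z \<Longrightarrow> veq (\<Phi> y ((!) z)) (\<lambda>_. 0)"
    by (metis Diff_iff singletonD)
  have C: "vop k (\<lambda>X i. \<Sum>y\<in>nlists k A. f y 1 * \<Phi> y X i) \<in> C"
    by (intro vop_sum vop_scale k finite_nlists \<Phi>(1))
  have "f xs = vec (\<lambda>i. \<Sum>y\<in>nlists k A. f y 1 * \<Phi> y ((!) xs) i)" if xs: "xs \<in> nlists k A" for xs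
  proof -
    have "[(\<Sum>y\<in>nlists k A. f y 1 * \<Phi> y ((!) xs) 1) = (\<Sum>y\<in>nlists k A. if y = xs then f y 1 else 0)] (mod M 1)"
    proof (rule cong_sum)
      fix y assume y: "y \<in> nlists k A"
      show "[f y 1 * \<Phi> y ((!) xs) 1 = (if y = xs then f y 1 else 0)] (mod M 1)"
        using \<Phi>(2)[OF y] \<Phi>(3)[OF y xs]
          cong_scalar_left[of "\<Phi> y ((!) xs) 1" _ "M 1" "f y 1"] by (fastforce simp: veq_iff)
    qed
    also have "(\<Sum>y\<in>nlists k A. if y = xs then f y 1 else 0) = f xs 1"
      using xs finite_nlists by simp
    finally have "vec (f xs) = vec (\<lambda>i. \<Sum>y\<in>nlists k A. f y 1 * \<Phi> y ((!) xs) i)"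
      by (simp add: vec_eq_iff veq_iff cong_sym)
    moreover have "f xs \<in> A" using fA xs by auto
    ultimately show ?thesis by (simp add: vec_id)
  qed
  then have "(\<lambda>xs\<in>nlists k A. f xs) = (\<lambda>xs\<in>nlists k A. vec (\<lambda>i. \<Sum>y\<in>nlists k A. f y 1 * \<Phi> y ((!) xs) i))"
    by (rule restrict_ext)
  then have "(k, f) = vop k (\<lambda>X i. \<Sum>y\<in>nlists k A. f y 1 * \<Phi> y X i)"
    using fA by (simp add: vop_def PiE_def extensional_restrict)
  then show "(k, f) \<in> C" using C by simp
qed

text \<open>Either every member of \<open>C\<close> is additive up to its value at 0, hence affine,
  or a failure of additivity at some \<open>a\<close>, \<open>b\<close> provides the binary
  operation needed for interpolation.\<close>

lemma subset_Pol_or_operations: "C \<subseteq> Pol A ops \<or> operations A \<subseteq> C"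
proof (cases "\<exists>k f a b. (k, f) \<in> C \<and>
    \<not> [f (map (\<lambda>j. vec (\<lambda>_. a j + b j)) [0..<k]) 1 + f (map (\<lambda>j. vec (\<lambda>_. 0)) [0..<k]) 1
      = f (map (\<lambda>j. vec (\<lambda>_. a j)) [0..<k]) 1 + f (map (\<lambda>j. vec (\<lambda>_. b j)) [0..<k]) 1] (mod M 1)")
  case True
  then obtain k f a b where f: "(k, f) \<in> C" and
    ne: "\<not> [f (map (\<lambda>j. vec (\<lambda>_. a j + b j)) [0..<k]) 1 + f (map (\<lambda>j. vec (\<lambda>_. 0)) [0..<k]) 1
      = f (map (\<lambda>j. vec (\<lambda>_. a j)) [0..<k]) 1 + f (map (\<lambda>j. vec (\<lambda>_. b j)) [0..<k]) 1] (mod M 1)"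
    by blast
  define F where "F Y = f (map (\<lambda>j. vec (Y j)) [0..<k])" for Y
  have F_cong: "F Y = F Y'" if "\<And>j. [Y j 1 = Y' j 1] (mod M 1)" for Y Y'
  proof -
    have "vec (Y j) = vec (Y' j)" for j using that by (simp add: vec_eq_iff veq_iff)
    then show ?thesis by (simp add: F_def)
  qed
  have F_vop: "vop 2 (\<lambda>X. F (\<lambda>j i. s j * X 0 i + t j * X 1 i)) \<in> C" for s t
    unfolding F_def by (intro vop_compose[OF f] vop_add vop_scale vop_nth) auto
  \<comment> \<open>The mixed difference of \<open>F\<close> along \<open>a\<close> and
    \<open>b\<close>: its terms cancel in pairs when one variable is 0, and at (1,1) it is the
    defect of additivity. The factors 0 give all four terms the shape required by
    \<open>F_vop\<close>.\<close>
  define \<gamma> where "\<gamma> X i = (F (\<lambda>j i. a j * X 0 i + b j * X 1 i) i + - F (\<lambda>j i. a j * X 0 i + 0 * X 1 i) i)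
     + (- F (\<lambda>j i. 0 * X 0 i + b j * X 1 i) i + F (\<lambda>j i. 0 * X 0 i + 0 * X 1 i) i)"
    for X :: "nat \<Rightarrow> nat \<Rightarrow> int" and i
  have "vop 2 \<gamma> \<in> C"
    unfolding \<gamma>_def by (intro vop_add vop_uminus F_vop) auto
  then have g: "(2, snd (vop 2 \<gamma>)) \<in> C" by (simp add: vop_def)
  have g_eq: "veq (snd (vop 2 \<gamma>) [vec w, vec w']) (\<gamma> ((!) [vec w, vec w']))" for w w'
    by (subst snd_vop) (auto intro!: nlistsI)
  have "operations A \<subseteq> C"
  proof (rule operations_subset[OF g])
    fix w w' assume w: "veq w (\<lambda>_. 0) \<or> veq w' (\<lambda>_. 0)"
    have *: "[vec w 1 = w 1] (mod M 1)" "[vec w' 1 = w' 1] (mod M 1)"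
      using veq_vec(1)[of w] veq_vec(1)[of w'] by (simp_all only: veq_iff)
    have w: "[vec w 1 = 0] (mod M 1) \<or> [vec w' 1 = 0] (mod M 1)"
      using w * cong_trans unfolding veq_iff by blast
    have "\<gamma> ((!) [vec w, vec w']) 1 = 0"
    proof -
      from w show ?thesis
      proof
        assume 0: "[vec w 1 = 0] (mod M 1)"
        have z: "[s * vec w 1 = 0] (mod M 1)" for s using cong_scalar_left[OF 0, of s] by simp
        have 1: "[s * vec w 1 = s' * vec w 1] (mod M 1)" for s s'
          by (rule cong_trans[OF z cong_sym[OF z]])
        have "F (\<lambda>j i. a j * vec w i + b j * vec w' i) = F (\<lambda>j i. 0 * vec w i + b j * vec w' i)"
          "F (\<lambda>j i. a j * vec w i + 0 * vec w' i) = F (\<lambda>j i. 0 * vec w i + 0 * vec w' i)"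
          by (rule F_cong, intro cong_add 1 cong_refl)+
        then show ?thesis by (simp add: \<gamma>_def)
      next
        assume 0: "[vec w' 1 = 0] (mod M 1)"
        have z: "[s * vec w' 1 = 0] (mod M 1)" for s using cong_scalar_left[OF 0, of s] by simp
        have 2: "[s * vec w' 1 = s' * vec w' 1] (mod M 1)" for s s'
          by (rule cong_trans[OF z cong_sym[OF z]])
        have "F (\<lambda>j i. a j * vec w i + b j * vec w' i) = F (\<lambda>j i. a j * vec w i + 0 * vec w' i)"
          "F (\<lambda>j i. 0 * vec w i + b j * vec w' i) = F (\<lambda>j i. 0 * vec w i + 0 * vec w' i)"
          by (rule F_cong, intro cong_add 2 cong_refl)+
        then show ?thesis by (simp add: \<gamma>_def)
      qed
    qed
    then show "veq (snd (vop 2 \<gamma>) [vec w, vec w']) (\<lambda>_. 0)"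
      using g_eq[of w w'] by (simp add: veq_iff)
  next
    have 1: "[s * vec (\<lambda>_. 1) 1 + t * vec (\<lambda>_. 1) 1 = s + t] (mod M 1)" for s t
    proof -
      have "[vec (\<lambda>_. 1) 1 = 1] (mod M 1)" using veq_vec(1)[of "\<lambda>_. 1"] by (simp only: veq_iff)
      from cong_add[OF cong_scalar_left[OF this, of s] cong_scalar_left[OF this, of t]]
      show ?thesis by simp
    qed
    have eqs: "F (\<lambda>j i. a j * vec (\<lambda>_. 1) i + b j * vec (\<lambda>_. 1) i) = F (\<lambda>j _. a j + b j)"
      "F (\<lambda>j i. a j * vec (\<lambda>_. 1) i + 0 * vec (\<lambda>_. 1) i) = F (\<lambda>j _. a j)"
      "F (\<lambda>j i. 0 * vec (\<lambda>_. 1) i + b j * vec (\<lambda>_. 1) i) = F (\<lambda>j _. b j)"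
      "F (\<lambda>j i. 0 * vec (\<lambda>_. 1) i + 0 * vec (\<lambda>_. 1) i) = F (\<lambda>j _. 0)"
      by (rule F_cong, use 1[of "a _" "b _"] 1[of "a _" 0] 1[of 0 "b _"] in simp)+
    have "\<gamma> ((!) [vec (\<lambda>_. 1), vec (\<lambda>_. 1)]) 1 = F (\<lambda>j _. a j + b j) 1 - F (\<lambda>j _. a j) 1 - F (\<lambda>j _. b j) 1 + F (\<lambda>j _. 0) 1"
      unfolding \<gamma>_def nth_Cons_0 One_nat_def nth_Cons_Suc eqs[unfolded One_nat_def] by simp
    moreover have "\<not> [F (\<lambda>j _. a j + b j) 1 - F (\<lambda>j _. a j) 1 - F (\<lambda>j _. b j) 1 + F (\<lambda>j _. 0) 1 = 0] (mod M 1)"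
      using ne by (simp add: F_def cong_iff_dvd_diff algebra_simps)
    ultimately have "\<not> veq (\<gamma> ((!) [vec (\<lambda>_. 1), vec (\<lambda>_. 1)])) (\<lambda>_. 0)"
      by (simp only: veq_iff) simp
    then show "\<not> veq (snd (vop 2 \<gamma>) [vec (\<lambda>_. 1), vec (\<lambda>_. 1)]) (\<lambda>_. 0)"
      using veq_trans[OF veq_sym[OF g_eq[of "\<lambda>_. 1" "\<lambda>_. 1"]]] by blast
  qed
  then show ?thesis ..
next
  case False
  have "(k, f) \<in> Pol A ops" if f: "(k, f) \<in> C" for k f
  proof -
    have op: "(k, f) \<in> operations A" using f by (rule in_operations)
    then have k: "1 \<le> k" by (simp add: operations_def)
    define \<phi> where "\<phi> x = f (map (\<lambda>j. vec (\<lambda>_. x j)) [0..<k]) 1" for x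
    have "\<exists>c. \<forall>x. [\<phi> x = \<phi> (\<lambda>_. 0) + (\<Sum>j<k. c j * x j)] (mod M 1)"
    proof (rule additive_mod_imp_affine)
      show "0 < M 1" using M_pos[of 1] by (simp add: I)
      show "\<phi> x = \<phi> y" if "\<And>j. j < k \<Longrightarrow> [x j = y j] (mod M 1)" for x y
      proof -
        have "map (\<lambda>j. vec (\<lambda>_. x j)) [0..<k] = map (\<lambda>j. vec (\<lambda>_. y j)) [0..<k]"
          using that by (simp add: vec_eq_iff veq_iff)
        then show ?thesis unfolding \<phi>_def by (simp only:)
      qed
      show "[\<phi> (\<lambda>j. a j + b j) + \<phi> (\<lambda>_. 0) = \<phi> a + \<phi> b] (mod M 1)" for a b
        using False f unfolding \<phi>_def by blast
    qed
    then obtain c where c: "\<And>x. [\<phi> x = \<phi> (\<lambda>_. 0) + (\<Sum>j<k. c j * x j)] (mod M 1)" by blast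
    have "veq (f (map (\<lambda>j. vec (X j)) [0..<k])) (affine k (\<lambda>_. \<phi> (\<lambda>_. 0)) c X)" for X
    proof -
      have "vec (X j) = vec (\<lambda>_. X j 1)" for j by (simp add: vec_eq_iff veq_iff)
      then have "f (map (\<lambda>j. vec (X j)) [0..<k]) 1 = \<phi> (\<lambda>j. X j 1)" by (simp add: \<phi>_def)
      then show ?thesis using c[of "\<lambda>j. X j 1"] by (simp add: veq_iff affine_def)
    qed
    then have "vop k (\<lambda>X. f (map (\<lambda>j. vec (X j)) [0..<k])) = vop k (affine k (\<lambda>_. \<phi> (\<lambda>_. 0)) c)"
      by (rule vop_eqI)
    then show ?thesis using operation_eq_vop[OF op] affine_in_Pol[OF k] by simp
  qed
  then have "C \<subseteq> Pol A ops" by auto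
  then show ?thesis ..
qed

end

lemma (in residue_product) prime_field_finitely_many_expansions:
  assumes "I = {1}" "prime (M 1)"
  shows "finitely_many_cp_expansions A ops"
proof -
  have "C \<in> {Pol A ops, operations A}" if C: "is_clone A C" "Pol A ops \<subseteq> C" for C
  proof -
    interpret clone_over I M C using C by (rule clone_over_Pol)
    interpret clone_over_prime_field I M C by unfold_locales (use assms in auto)
    have "C \<subseteq> operations A" using in_operations by blast
    then show ?thesis using subset_Pol_or_operations C(2) by blast
  qed
  then have "{C. is_clone A C \<and> Pol A ops \<subseteq> C \<and> C \<subseteq> Comp A ops} \<subseteq> {Pol A ops, operations A}"
    by blast
  then show ?thesis
    unfolding finitely_many_cp_expansions_def by (rule finite_subset) simp
qed

section \<open>The classification\<close>

theorem corollary3: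
  fixes p r :: nat and m :: "nat \<Rightarrow> nat"
  defines "G \<equiv> product_group {1..r} (\<lambda>i. integer_mod_group (p ^ m i))"
  assumes "prime p"
    and "1 \<le> r"
    and "\<And>i. i \<in> {1..r} \<Longrightarrow> 1 \<le> m i"
    and "\<And>i j. 1 \<le> i \<Longrightarrow> i \<le> j \<Longrightarrow> j \<le> r \<Longrightarrow> m j \<le> m i"
  shows "finitely_many_cp_expansions (carrier G) (group_operations G) \<longleftrightarrow>
           (2 \<le> r \<and> m 1 = m 2) \<or> (r = 1 \<and> m 1 = 1)"
proof -
  have p: "0 < p" using \<open>prime p\<close> by (rule prime_gt_0_nat)
  note G = residue_product_group[OF p, of "{1..r}" m, folded G_def]
  interpret residue_product "{1..r}" "\<lambda>i. int p ^ m i" by (rule G(1))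
  note G_eq = G(2,3)
  \<comment> \<open>The case \<open>single\<close> covers both \<open>r = 1\<close> with
    \<open>2 \<le> m 1\<close>, where the condition on the other indices is vacuous, and
    \<open>m 2 < m 1\<close>, where \<open>1 \<le> m 2\<close> gives
    \<open>2 \<le> m 1\<close>.\<close>
  consider (equal) "2 \<le> r" "m 1 = m 2" | (field) "r = 1" "m 1 = 1"
    | (single) "2 \<le> m 1" "\<And>i. i \<in> {1..r} \<Longrightarrow> i \<noteq> 1 \<Longrightarrow> m i < m 1"
        "\<not> ((2 \<le> r \<and> m 1 = m 2) \<or> (r = 1 \<and> m 1 = 1))"
  proof -
    have m1: "1 \<le> m 1" using assms(3,4) by simp
    show thesis
    proof (cases "2 \<le> r")
      case True
      have 2: "m 2 \<le> m 1" "1 \<le> m 2" using assms(4,5) True by simp_all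
      have "m i \<le> m 2" if "i \<in> {1..r}" "i \<noteq> 1" for i
        using assms(5)[of 2 i] that by simp
      then show thesis using True 2 equal single by (cases "m 1 = m 2") force+
    next
      case False
      then have "r = 1" using assms(3) by simp
      then show thesis using m1 field single by (cases "m 1 = 1") force+
    qed
  qed
  then show ?thesis
  proof cases
    case equal
    have "m i \<le> m 1" if "i \<in> {1..r}" for i using assms(5)[of 1 i] that by simp
    then interpret two_maximal_factors "{1..r}" "\<lambda>i. int p ^ m i" "int p ^ m 1" 1 2
      by unfold_locales (use equal in \<open>auto intro: le_imp_power_dvd\<close>)
    show ?thesis using finitely_many_expansions equal unfolding G_eq by blast
  next
    case field
    have "finitely_many_cp_expansions A ops"
      by (rule prime_field_finitely_many_expansions) (use field \<open>prime p\<close> in auto)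
    then show ?thesis using field unfolding G_eq by blast
  next
    case single
    \<comment> \<open>Here \<open>2 \<le> m 1\<close> makes \<open>p\<close> divide
      \<open>c\<close>, and strict maximality of \<open>m 1\<close> makes the other moduli divide
      \<open>c\<close>.\<close>
    interpret single_maximal_factor "{1..r}" "\<lambda>i. int p ^ m i" "int p" "int p ^ (m 1 - 1)" 1
    proof unfold_locales
      show "int p ^ m 1 = int p * int p ^ (m 1 - 1)"
        using single(1) by (simp flip: power_Suc)
      show "int p dvd int p ^ (m 1 - 1)" using single(1) by simp
      show "int p ^ m i dvd int p ^ (m 1 - 1)" if "i \<in> {1..r}" "i \<noteq> 1" for i
        using single(2)[OF that] by (intro le_imp_power_dvd) simp
    qed (use assms(3) \<open>prime p\<close> in auto)
    show ?thesis using infinitely_many_expansions single(3) unfolding G_eq by blast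
  qed
qed

end
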